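(* Let $\mathcal{A}$ be a unital $C^*$-algebra, let $n$ be a positive integer, and let $\Phi:\mathcal{A}\to\mathbb{M}_n$ be a positive linear map which is sub-unital, i.e. $\Phi(I)\le I$. Let $A\in\mathcal{A}$ be positive and let $p,q,r\ge 0$ be real numbers such that $\min\{p,r\}\le q/2$ and $\max\{p,r\}\le q$. Then there exists a unitary $V\in\mathbb{M}_n$ such that $$|\Phi(A^p)\Phi(A^q)\Phi(A^r)|\le V\Phi(A^{p+q+r})V^*.$$
   Context: $\mathbb{M}_n$ is the algebra of $n\times n$ complex matrices. Units are denoted by $I$. A linear map is positive if it maps positive elements to positive elements (positive semidefinite matrices in the case of $\mathbb{M}_n$). $|X|=(X^*X)^{1/2}$. Powers of positive elements are defined by functional calculus, with $A^0=I$. *)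

theory Defs
  imports "HOL-Analysis.Analysis" "HOL-Computational_Algebra.Polynomial"
begin

section \<open>Unital C*-algebras\<close>

text \<open>As usual for unital Banach algebras the unit has norm 1, so the zero algebra is excluded.\<close>

class unital_cstar_algebra = real_normed_algebra_1 + banach +
  fixes scaleC :: "complex \<Rightarrow> 'a \<Rightarrow> 'a"  (infixr \<open>*\<^sub>C\<close> 75)
    and star :: "'a \<Rightarrow> 'a"
  assumes scaleC_add_right: "c *\<^sub>C (x + y) = c *\<^sub>C x + c *\<^sub>C y"
    and scaleC_add_left: "(c + d) *\<^sub>C x = c *\<^sub>C x + d *\<^sub>C x"
    and scaleC_scaleC: "c *\<^sub>C d *\<^sub>C x = (c * d) *\<^sub>C x"
    and scaleR_scaleC: "scaleR t x = complex_of_real t *\<^sub>C x"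
    and mult_scaleC_left: "(c *\<^sub>C x) * y = c *\<^sub>C (x * y)"
    and mult_scaleC_right: "x * (c *\<^sub>C y) = c *\<^sub>C (x * y)"
    and norm_scaleC: "norm (c *\<^sub>C x) = cmod c * norm x"
    and star_star: "star (star x) = x"
    and star_add: "star (x + y) = star x + star y"
    and star_scaleC: "star (c *\<^sub>C x) = cnj c *\<^sub>C star x"
    and star_mult: "star (x * y) = star y * star x"
    and cstar_identity: "norm (star x * x) = (norm x)\<^sup>2"

definition spectrum :: "'a::unital_cstar_algebra \<Rightarrow> complex set" where
  "spectrum a = {z. \<not> (\<exists>b. (a - z *\<^sub>C 1) * b = 1 \<and> b * (a - z *\<^sub>C 1) = 1)}"

definition positive_element :: "'a::unital_cstar_algebra \<Rightarrow> bool" where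
  "positive_element a \<longleftrightarrow> star a = a \<and> (\<forall>z\<in>spectrum a. z \<in> \<real> \<and> 0 \<le> Re z)"

definition poly_at :: "real poly \<Rightarrow> 'a::unital_cstar_algebra \<Rightarrow> 'a" where
  "poly_at P a = (\<Sum>i\<le>degree P. coeff P i *\<^sub>R a ^ i)"

text \<open>
  Continuous functional calculus for a self-adjoint \<open>a\<close> (whose spectrum is real) and a
  real-valued \<open>f\<close> continuous on the spectrum: \<open>f(a)\<close> is the common limit of
  \<open>P\<^sub>k(a)\<close> over all polynomial sequences converging to \<open>f\<close> uniformly on the spectrum.
\<close>

definition cfc :: "(real \<Rightarrow> real) \<Rightarrow> 'a::unital_cstar_algebra \<Rightarrow> 'a" where
  "cfc f a = (THE b. \<forall>P :: nat \<Rightarrow> real poly.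
     uniform_limit {t. complex_of_real t \<in> spectrum a} (\<lambda>k. poly (P k)) f sequentially
       \<longrightarrow> (\<lambda>k. poly_at (P k) a) \<longlonglongrightarrow> b)"

text \<open>The case distinction is needed because \<open>0 powr 0 = 0\<close>, whereas \<open>a\<^sup>0\<close> is the unit.\<close>

definition pos_power :: "'a::unital_cstar_algebra \<Rightarrow> real \<Rightarrow> 'a" where
  "pos_power a s = cfc (\<lambda>t. if s = 0 then 1 else t powr s) a"

section \<open>Complex matrices\<close>

definition conj_transpose :: "complex^'n^'m \<Rightarrow> complex^'m^'n" where
  "conj_transpose A = (\<chi> i j. cnj (A $ j $ i))"

definition psd :: "complex^'n^'n \<Rightarrow> bool" where
  "psd A \<longleftrightarrow> conj_transpose A = A \<and>
     (\<forall>x. 0 \<le> Re (\<Sum>i\<in>UNIV. cnj (x $ i) * (A *v x) $ i))"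

text \<open>The library order on vectors is componentwise, hence a separate name for the Loewner order.\<close>

definition loewner_le :: "complex^'n^'n \<Rightarrow> complex^'n^'n \<Rightarrow> bool"  (infix \<open>\<le>\<^sub>L\<close> 50) where
  "A \<le>\<^sub>L B \<longleftrightarrow> psd (B - A)"

definition unitary_matrix :: "complex^'n^'n \<Rightarrow> bool" where
  "unitary_matrix V \<longleftrightarrow> conj_transpose V ** V = mat 1 \<and> V ** conj_transpose V = mat 1"

definition psd_sqrt :: "complex^'n^'n \<Rightarrow> complex^'n^'n" where
  "psd_sqrt A = (THE S. psd S \<and> S ** S = A)"

definition matrix_abs :: "complex^'n^'n \<Rightarrow> complex^'n^'n" where
  "matrix_abs X = psd_sqrt (conj_transpose X ** X)"

section \<open>Linear maps from a C*-algebra to matrices\<close>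

definition complex_linear_map :: "('a::unital_cstar_algebra \<Rightarrow> complex^'n^'n) \<Rightarrow> bool" where
  "complex_linear_map \<Phi> \<longleftrightarrow>
     (\<forall>x y. \<Phi> (x + y) = \<Phi> x + \<Phi> y) \<and> (\<forall>c x. \<Phi> (c *\<^sub>C x) = (\<chi> i j. c * \<Phi> x $ i $ j))"

definition positive_map :: "('a::unital_cstar_algebra \<Rightarrow> complex^'n^'n) \<Rightarrow> bool" where
  "positive_map \<Phi> \<longleftrightarrow> (\<forall>x. positive_element x \<longrightarrow> psd (\<Phi> x))"

definition sub_unital :: "('a::unital_cstar_algebra \<Rightarrow> complex^'n^'n) \<Rightarrow> bool" where
  "sub_unital \<Phi> \<longleftrightarrow> \<Phi> 1 \<le>\<^sub>L mat 1"

end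

theory Submission
  imports Defs "HOL-Computational_Algebra.Fundamental_Theorem_Algebra"
begin

text \<open>
  Put \<open>S s = \<Phi> (A\<^sup>s)\<close>. Bernstein approximation of \<open>t\<^sup>s\<close> writes \<open>S s\<close> as a limit of sums
  \<open>\<Sum>\<^sub>k x\<^sub>k\<^sup>s C\<^sub>k\<close> with \<open>C\<^sub>k\<close> positive semidefinite and \<open>\<Sum>\<^sub>k C\<^sub>k \<le> 1\<close>. Hence scalar inequalities
  between powers of \<open>t\<close> pass to the family \<open>S\<close>, and Kadison's inequality \<open>(S s)\<^sup>2 \<le> S (2 s)\<close> holds
  although \<open>\<Phi>\<close> is merely positive.

  Taking adjoints if necessary, assume \<open>p \<le> q / 2\<close>. Let \<open>E\<close> be the span of the eigenvectors of
  \<open>S q\<close> with eigenvalue below \<open>\<beta>\<^sup>q\<close>. The tangent line of \<open>x\<^bsup>u/q\<^esup>\<close> at \<open>\<beta>\<^sup>q\<close> gives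
  \<open>S u \<le> \<beta>\<^sup>u\<close> on \<open>E\<close> for \<open>u \<le> q\<close> (in the sense of quadratic forms), and \<open>S u \<ge> \<beta>\<^sup>u\<close> on the
  orthogonal complement of \<open>E\<close> for \<open>u \<ge> q\<close>. With \<open>u = r\<close> and \<open>u = 2 p\<close> it follows that
  \<open>\<parallel>S p S q S r h\<parallel> < \<beta>\<^bsup>p+q+r\<^esup> \<parallel>h\<parallel>\<close> for every nonzero \<open>h\<close> with \<open>S r h \<in> E\<close>.
  Counting dimensions, every singular value of the product is at most the corresponding
  eigenvalue of \<open>S (p + q + r)\<close>, and diagonalizing both matrices yields the unitary.
\<close>

section \<open>Diagonalization of Hermitian matrices\<close>

lemma conj_transpose_conj_transpose [simp]: "conj_transpose (conj_transpose M) = M"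
  by (simp add: conj_transpose_def vec_eq_iff)

lemma conj_transpose_mult: "conj_transpose (M ** N) = conj_transpose N ** conj_transpose M"
  by (simp add: conj_transpose_def vec_eq_iff matrix_matrix_mult_def mult.commute)

lemma conj_transpose_diff: "conj_transpose (M - N) = conj_transpose M - conj_transpose N"
  and conj_transpose_scaleR: "conj_transpose (c *\<^sub>R M) = c *\<^sub>R conj_transpose M"
  by (simp_all add: conj_transpose_def vec_eq_iff)

lemma scaleR_vec_component: "(t *\<^sub>R x) $ i = complex_of_real t * x $ i"
  unfolding vector_scaleR_component by (rule scaleR_conv_of_real)

lemma matrix_vector_scaleR: "M *v (t *\<^sub>R x) = t *\<^sub>R (M *v x)" for M :: "complex^'n^'m"
  by (simp add: linear_scale)

lemma scaleR_matrix_vector: "(t *\<^sub>R M) *v x = t *\<^sub>R (M *v x)" for M :: "complex^'n^'m"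
  by (simp add: vec_eq_iff matrix_vector_mult_def scaleR_sum_right)

section \<open>The complex inner product, its real part, and positive semidefinite forms\<close>

definition cdot :: "complex^'n \<Rightarrow> complex^'n \<Rightarrow> complex" where
  "cdot x y = (\<Sum>i\<in>UNIV. cnj (x $ i) * y $ i)"

lemma inner_complex_vec: "x \<bullet> y = Re (cdot x y)" for x y :: "complex^'n"
  by (simp add: inner_vec_def cdot_def inner_complex_def)

lemma cdot_adjoint: "cdot (conj_transpose M *v x) y = cdot x (M *v y)"
proof -
  have "cdot (conj_transpose M *v x) y = (\<Sum>i\<in>UNIV. \<Sum>j\<in>UNIV. M $ j $ i * cnj (x $ j) * y $ i)"
    by (simp add: cdot_def conj_transpose_def matrix_vector_mult_def sum_distrib_right)
  also have "\<dots> = (\<Sum>j\<in>UNIV. \<Sum>i\<in>UNIV. M $ j $ i * cnj (x $ j) * y $ i)"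
    by (rule sum.swap)
  also have "\<dots> = cdot x (M *v y)"
    by (simp add: cdot_def matrix_vector_mult_def sum_distrib_left mult_ac)
  finally show ?thesis .
qed

lemma cdot_cnj: "cnj (cdot x y) = cdot y x"
  by (simp add: cdot_def mult.commute)

lemma cdot_scale: "cdot x (c *s y) = c * cdot x y" "cdot (c *s x) y = cnj c * cdot x y"
  by (simp_all add: cdot_def sum_distrib_left mult_ac)

lemma cdot_scaleR: "cdot x (t *\<^sub>R y) = of_real t * cdot x y"
  by (simp only: cdot_def sum_distrib_left scaleR_vec_component mult_ac)

lemma cdot_self: "cdot x x = of_real ((norm x)\<^sup>2)"
proof -
  have "Im (cdot x x) = 0"
    by (simp add: cdot_def)
  moreover have "Re (cdot x x) = (norm x)\<^sup>2"
    by (simp add: power2_norm_eq_inner inner_complex_vec)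
  ultimately show ?thesis
    by (simp add: complex_eq_iff)
qed

lemma cdot_diff: "cdot x (y - z) = cdot x y - cdot x z"
  by (simp add: cdot_def algebra_simps sum_subtractf)

lemma inner_adjoint: "(conj_transpose M *v x) \<bullet> y = x \<bullet> (M *v y)"
  by (simp add: inner_complex_vec cdot_adjoint)

lemma inner_adjoint_right: "x \<bullet> (conj_transpose M *v y) = (M *v x) \<bullet> y"
  using inner_adjoint[of M y x] by (simp add: inner_commute)

lemma psd_iff: "psd M \<longleftrightarrow> conj_transpose M = M \<and> (\<forall>x. 0 \<le> x \<bullet> (M *v x))"
  by (simp add: psd_def inner_complex_vec cdot_def)

lemma psd_inner_commute: "psd M \<Longrightarrow> x \<bullet> (M *v y) = y \<bullet> (M *v x)"
  using inner_adjoint[of M x y] by (simp add: psd_iff inner_commute)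

text \<open>For small \<open>t\<close> of sign opposite to \<open>b\<close> the linear term
  dominates the quadratic one. This turns maximality of a quadratic form into a first-order
  condition.\<close>

lemma affine_quadratic_nonneg:
  fixes b c :: real
  assumes "\<And>t. 0 \<le> 2 * t * b + t\<^sup>2 * c"
  shows "b = 0"
proof (rule ccontr)
  assume "b \<noteq> 0"
  define t where "t = - b / (\<bar>c\<bar> + 1)"
  have "2 * t * b + t\<^sup>2 * c \<le> 2 * t * b + t\<^sup>2 * (\<bar>c\<bar> + 1)"
    by (intro add_left_mono mult_left_mono) auto
  also have "\<dots> = - b\<^sup>2 / (\<bar>c\<bar> + 1)"
    by (simp add: t_def power2_eq_square divide_simps)
  also have "\<dots> < 0"
    using \<open>b \<noteq> 0\<close> by (simp add: divide_neg_pos)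
  finally show False
    using assms[of t] by simp
qed

lemma psd_Cauchy_Schwarz:
  assumes "psd M"
  shows "(x \<bullet> (M *v y))\<^sup>2 \<le> (x \<bullet> (M *v x)) * (y \<bullet> (M *v y))"
proof -
  define a b c where "a = x \<bullet> (M *v x)" and "b = x \<bullet> (M *v y)" and "c = y \<bullet> (M *v y)"
  have nonneg: "0 \<le> a + 2 * t * b + t\<^sup>2 * c" for t
  proof -
    have "0 \<le> (x + t *\<^sub>R y) \<bullet> (M *v (x + t *\<^sub>R y))"
      using assms by (simp add: psd_iff)
    also have "\<dots> = a + 2 * t * b + t\<^sup>2 * c"
      using psd_inner_commute[OF assms, of y x]
      by (simp add: a_def b_def c_def matrix_vector_right_distrib matrix_vector_scaleR
          inner_add_left inner_add_right power2_eq_square algebra_simps)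
    finally show ?thesis .
  qed
  have "0 \<le> c" "0 \<le> a"
    using assms by (auto simp: c_def a_def psd_iff)
  show ?thesis
  proof (cases "c = 0")
    case True
    \<comment> \<open>With \<open>c = 0\<close> the form along the line is affine in
      \<open>t\<close>; the value of \<open>t\<close> chosen below makes it equal to -1 when
      \<open>b\<close> is nonzero.\<close>
    have "b = 0"
    proof (rule ccontr)
      assume "b \<noteq> 0"
      then have "2 * (- (a + 1) / (2 * b)) * b = - (a + 1)"
        by simp
      then show False
        using nonneg[of "- (a + 1) / (2 * b)"] True by simp
    qed
    then show ?thesis
      using \<open>c = 0\<close> by (simp add: b_def c_def)
  next
    case False
    then have "c > 0" using \<open>0 \<le> c\<close> by simp
    have "a + 2 * (- b / c) * b + (- b / c)\<^sup>2 * c = a - b\<^sup>2 / c"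
      using \<open>c > 0\<close> by (simp add: power2_eq_square field_simps)
    then have "0 \<le> a - b\<^sup>2 / c"
      using nonneg[of "- b / c"] by simp
    then show ?thesis
      using \<open>c > 0\<close> unfolding a_def[symmetric] b_def[symmetric] c_def[symmetric]
      by (simp add: field_simps)
  qed
qed

section \<open>Linear systems and orthonormal eigenvectors\<close>

lemma homogeneous_system_nontrivial_solution:
  fixes m :: "'n::finite \<Rightarrow> complex^'n" and I :: "'n set" and K :: "'n set"
  assumes "card K < card I"
  shows "\<exists>x. x \<noteq> 0 \<and> (\<forall>i. i \<notin> I \<longrightarrow> x $ i = 0) \<and> (\<forall>k\<in>K. (\<Sum>i\<in>UNIV. m k $ i * x $ i) = 0)"
proof -
  obtain f where f: "inj_on f K" "f ` K \<subseteq> I"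
    using assms by (metis card_le_inj finite_code less_imp_le)
  have "card (f ` K) < card I"
    using assms f by (simp add: card_image)
  then obtain i0 where i0: "i0 \<in> I" "i0 \<notin> f ` K"
    by (metis card_mono finite_code not_less subsetI)
  define N :: "complex^'n^'n" where
    "N = (\<chi> j. if j \<notin> I then axis j 1 else if j \<in> f ` K then m (inv_into K f j) else 0)"
  have "row i0 N = 0"
    using i0 by (simp add: row_def N_def vec_eq_iff)
  then have "\<not> invertible N"
    using invertible_det_nz det_zero_row by blast
  then obtain x where x: "x \<noteq> 0" "N *v x = 0"
    by (metis invertible_left_inverse matrix_left_invertible_ker)
  have "x $ i = 0" if "i \<notin> I" for i
  proof -
    have "(N *v x) $ i = (\<Sum>j\<in>UNIV. axis i 1 $ j * x $ j)"
      using that by (simp add: matrix_vector_mult_def N_def)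
    also have "\<dots> = (\<Sum>j\<in>UNIV. (if j = i then x $ j else 0))"
      by (intro sum.cong) (auto simp: axis_def)
    finally show ?thesis using x by simp
  qed
  moreover have "(\<Sum>i\<in>UNIV. m k $ i * x $ i) = 0" if "k \<in> K" for k
  proof -
    have "(N *v x) $ f k = (\<Sum>i\<in>UNIV. m k $ i * x $ i)"
      using that f unfolding matrix_vector_mult_def by (auto simp: N_def inv_into_f_f)
    then show ?thesis using x by simp
  qed
  ultimately show ?thesis using x by blast
qed

text \<open>Induction over the index set: the orthogonal complement \<open>W\<close> of the
  eigenvectors found so far is invariant under \<open>M\<close>, and a maximizer of the quadratic
  form on its unit sphere is the next eigenvector.\<close>

lemma hermitian_orthonormal_eigenvectors:
  fixes M :: "complex^'n^'n" and I :: "'n set"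
  assumes "conj_transpose M = M"
  shows "\<exists>u d. (\<forall>i\<in>I. \<forall>j\<in>I. cdot (u i) (u j) = (if i = j then 1 else 0)) \<and>
    (\<forall>i\<in>I. M *v u i = complex_of_real (d i) *s u i)"
proof (induction I rule: finite_induct[OF finite])
  case 1
  then show ?case by simp
next
  case (2 k I)
  then obtain u d where u: "\<And>i j. i \<in> I \<Longrightarrow> j \<in> I \<Longrightarrow> cdot (u i) (u j) = (if i = j then 1 else 0)"
    and d: "\<And>i. i \<in> I \<Longrightarrow> M *v u i = complex_of_real (d i) *s u i" by blast
  define W where "W = {y. \<forall>i\<in>I. cdot (u i) y = 0}"
  have W_M: "M *v y \<in> W" if "y \<in> W" for y
    using that by (simp add: W_def assms d cdot_scale flip: cdot_adjoint)
  have W_add: "y + z \<in> W" "t *\<^sub>R y \<in> W" "y - z \<in> W" if "y \<in> W" "z \<in> W" for y z t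
    using that cdot_diff[of _ y "- z"] cdot_scaleR[of _ "-1" z]
    by (auto simp: W_def cdot_diff cdot_scaleR)
  have "card I < card (UNIV :: 'n set)"
    using 2 by (intro psubset_card_mono) auto
  from homogeneous_system_nontrivial_solution[OF this, of "\<lambda>i. \<chi> j. cnj (u i $ j)"]
  obtain w where w: "w \<noteq> 0" "w \<in> W"
    by (auto simp: W_def cdot_def)
  have "closed W"
    unfolding W_def cdot_def
    by (simp only: Collect_ball_eq, intro closed_INT ballI closed_Collect_eq continuous_intros)
  then have "compact (sphere 0 1 \<inter> W)"
    by (simp add: compact_Int_closed)
  moreover have "(1 / norm w) *\<^sub>R w \<in> sphere 0 1 \<inter> W"
    using w W_add by simp
  then have "sphere 0 1 \<inter> W \<noteq> {}"
    by blast
  moreover have "continuous_on (sphere 0 1 \<inter> W) (\<lambda>y. y \<bullet> (M *v y))"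
    by (intro continuous_intros linear_continuous_on matrix_vector_mul_bounded_linear)
  ultimately obtain x where x: "x \<in> sphere 0 1 \<inter> W"
    and max: "\<And>y. y \<in> sphere 0 1 \<inter> W \<Longrightarrow> y \<bullet> (M *v y) \<le> x \<bullet> (M *v x)"
    using continuous_attains_sup by meson
  define l where "l = x \<bullet> (M *v x)"
  have Q: "0 \<le> l * (y \<bullet> y) - y \<bullet> (M *v y)" if "y \<in> W" for y
  proof (cases "y = 0")
    case False
    have "((1 / norm y) *\<^sub>R y) \<bullet> (M *v ((1 / norm y) *\<^sub>R y)) \<le> l"
      unfolding l_def by (rule max) (use that False W_add in auto)
    then have "(y \<bullet> (M *v y)) / (norm y)\<^sup>2 \<le> l"
      by (simp add: matrix_vector_scaleR power2_eq_square)
    then show ?thesis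
      using False by (simp add: divide_le_eq power2_norm_eq_inner)
  qed simp
  have xx: "x \<bullet> x = 1"
    using x by (simp add: norm_eq_1)
  \<comment> \<open>The residual of the eigenvalue equation. Moving from \<open>x\<close> in
    direction \<open>z\<close> inside \<open>W\<close> changes the nonnegative form \<open>Q\<close>
    to first order by twice the squared norm of \<open>z\<close>, which therefore vanishes.\<close>
  define z where "z = l *\<^sub>R x - M *v x"
  have zW: "z \<in> W"
    unfolding z_def using x W_M W_add[of x x] W_add(3) by simp
  have sym: "z \<bullet> (M *v x) = x \<bullet> (M *v z)"
    using inner_adjoint[of M x z] assms by (simp add: inner_commute)
  have "0 \<le> 2 * t * (z \<bullet> z) + t\<^sup>2 * (l * (z \<bullet> z) - z \<bullet> (M *v z))" for t
  proof -
    have "0 \<le> l * ((x + t *\<^sub>R z) \<bullet> (x + t *\<^sub>R z)) - (x + t *\<^sub>R z) \<bullet> (M *v (x + t *\<^sub>R z))"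
      using Q W_add x zW by simp
    also have "\<dots> = 2 * t * (l * (z \<bullet> x) - z \<bullet> (M *v x)) + t\<^sup>2 * (l * (z \<bullet> z) - z \<bullet> (M *v z))"
      using sym xx
      by (simp add: matrix_vector_right_distrib matrix_vector_scaleR l_def
          inner_add_left inner_add_right power2_eq_square algebra_simps inner_commute)
    also have "l * (z \<bullet> x) - z \<bullet> (M *v x) = z \<bullet> z"
      by (subst (3) z_def) (simp add: inner_diff_right)
    finally show ?thesis .
  qed
  then have "z \<bullet> z = 0"
    by (rule affine_quadratic_nonneg)
  then have Mx: "M *v x = complex_of_real l *s x"
    by (metis (no_types, lifting) eq_iff_diff_eq_0 inner_eq_zero_iff scaleR_vec_component vec_eq_iff
        vector_smult_component z_def)
  have orth: "cdot (u i) x = 0" "cdot x (u i) = 0" if "i \<in> I" for i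
    using x that cdot_cnj[of "u i" x] by (auto simp: W_def)
  have x1: "cdot x x = 1"
    using xx by (simp add: cdot_self power2_norm_eq_inner)
  show ?case
    using u d Mx orth x1 2
    by (intro exI[of _ "u(k := x)"] exI[of _ "d(k := l)"]) auto
qed

section \<open>Diagonal matrices, unitary matrices and the spectral theorem\<close>

definition diag_mat :: "('n \<Rightarrow> real) \<Rightarrow> complex^'n^'n" where
  "diag_mat d = (\<chi> i j. if i = j then complex_of_real (d i) else 0)"

lemma diag_mat_vec: "(diag_mat d *v x) $ i = complex_of_real (d i) * x $ i"
proof -
  have "(diag_mat d *v x) $ i = (\<Sum>j\<in>UNIV. if i = j then complex_of_real (d i) * x $ j else 0)"
    unfolding diag_mat_def matrix_vector_mult_def vec_lambda_beta by (rule sum.cong) auto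
  then show ?thesis by simp
qed

lemma conj_transpose_diag_mat [simp]: "conj_transpose (diag_mat d) = diag_mat d"
  by (auto simp: conj_transpose_def diag_mat_def vec_eq_iff)

lemma diag_mat_mult: "diag_mat c ** diag_mat d = diag_mat (\<lambda>i. c i * d i)"
  by (simp add: matrix_eq flip: matrix_vector_mul_assoc) (simp add: vec_eq_iff diag_mat_vec)

lemma norm_vec_cmod: "(norm x)\<^sup>2 = (\<Sum>i\<in>UNIV. (cmod (x $ i))\<^sup>2)" for x :: "complex^'n"
  by (simp add: norm_vec_def L2_set_def sum_nonneg)

lemma norm_diag_mat:
  "(norm (diag_mat d *v x))\<^sup>2 = (\<Sum>i\<in>UNIV. (d i)\<^sup>2 * (cmod (x $ i))\<^sup>2)"
  by (simp add: norm_vec_cmod diag_mat_vec norm_mult power_mult_distrib)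

lemma inner_diag_mat: "x \<bullet> (diag_mat d *v x) = (\<Sum>i\<in>UNIV. d i * (cmod (x $ i))\<^sup>2)"
proof -
  have "x $ i \<bullet> (complex_of_real (d i) * x $ i) = d i * (cmod (x $ i))\<^sup>2" for i
    unfolding power2_norm_eq_inner by (simp add: inner_complex_def algebra_simps)
  then show ?thesis
    by (simp add: inner_vec_def diag_mat_vec)
qed

lemma unitary_matrix_iff: "unitary_matrix U \<longleftrightarrow> conj_transpose U ** U = mat 1"
  using matrix_left_right_inverse by (auto simp: unitary_matrix_def)

lemma unitary_conj_transpose: "unitary_matrix U \<Longrightarrow> unitary_matrix (conj_transpose U)"
  by (simp add: unitary_matrix_def)

lemma unitary_mult:
  assumes "unitary_matrix U" "unitary_matrix V"
  shows "unitary_matrix (U ** V)"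
proof -
  have "conj_transpose (U ** V) ** (U ** V) =
    conj_transpose V ** (conj_transpose U ** U) ** V"
    by (simp only: conj_transpose_mult matrix_mul_assoc)
  then show ?thesis
    using assms by (simp add: unitary_matrix_iff)
qed

lemma unitary_cancel:
  assumes "unitary_matrix U"
  shows "conj_transpose U *v (U *v x) = x" "U *v (conj_transpose U *v x) = x"
  using assms by (simp_all add: unitary_matrix_def matrix_vector_mul_assoc)

lemma unitary_norm:
  assumes "unitary_matrix U"
  shows "norm (U *v x) = norm x" "norm (conj_transpose U *v x) = norm x"
  using unitary_cancel[OF assms, of x] inner_adjoint[of U "U *v x" x]
    inner_adjoint[of U x "conj_transpose U *v x"]
  by (simp_all add: norm_eq_sqrt_inner)

theorem hermitian_diagonalization:
  fixes M :: "complex^'n^'n"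
  assumes "conj_transpose M = M"
  shows "\<exists>U d. unitary_matrix U \<and> M = U ** diag_mat d ** conj_transpose U"
proof -
  obtain u d where u: "\<And>i j :: 'n. cdot (u i) (u j) = (if i = j then 1 else 0)"
    and d: "\<And>i :: 'n. M *v u i = complex_of_real (d i) *s u i"
    using hermitian_orthonormal_eigenvectors[OF assms, of UNIV] by auto
  define U where "U = (\<chi> i j. u j $ i)"
  have "unitary_matrix U"
    using u by (simp add: unitary_matrix_iff U_def conj_transpose_def matrix_matrix_mult_def
        vec_eq_iff mat_def cdot_def)
  moreover have "M ** U = U ** diag_mat d"
  proof -
    have "(M ** U) $ i $ j = (M *v u j) $ i" for i j
      by (simp add: U_def matrix_matrix_mult_def matrix_vector_mult_def)
    moreover have "(U ** diag_mat d) $ i $ j = complex_of_real (d j) * u j $ i" for i j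
    proof -
      have "(U ** diag_mat d) $ i $ j = (\<Sum>k\<in>UNIV. if k = j then u j $ i * complex_of_real (d j) else 0)"
        unfolding U_def matrix_matrix_mult_def diag_mat_def vec_lambda_beta by (rule sum.cong) auto
      then show ?thesis by (simp add: mult.commute)
    qed
    ultimately show ?thesis
      by (simp add: vec_eq_iff d)
  qed
  ultimately show ?thesis
    by (metis matrix_mul_assoc matrix_mul_rid unitary_matrix_def)
qed

lemma inner_unitary_conj:
  "x \<bullet> ((U ** diag_mat d ** conj_transpose U) *v x) =
    (\<Sum>i\<in>UNIV. d i * (cmod ((conj_transpose U *v x) $ i))\<^sup>2)"
  unfolding inner_diag_mat[symmetric]
  by (simp add: inner_adjoint flip: matrix_vector_mul_assoc)

lemma psd_unitary_conj:
  assumes "\<And>i. 0 \<le> d i"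
  shows "psd (U ** diag_mat d ** conj_transpose U)"
  unfolding psd_iff inner_unitary_conj
  using assms by (auto simp: conj_transpose_mult matrix_mul_assoc intro!: sum_nonneg)

theorem psd_diagonalization:
  fixes M :: "complex^'n^'n"
  assumes "psd M"
  obtains U d where "unitary_matrix U" "M = U ** diag_mat d ** conj_transpose U" "\<And>i. 0 \<le> d i"
proof -
  obtain U d where U: "unitary_matrix U" "M = U ** diag_mat d ** conj_transpose U"
    using assms hermitian_diagonalization unfolding psd_iff by metis
  have "0 \<le> d i" for i
  proof -
    have "0 \<le> (U *v axis i 1) \<bullet> (M *v (U *v axis i 1))"
      using assms by (simp add: psd_iff)
    also have "\<dots> = (\<Sum>j\<in>UNIV. d j * (cmod ((axis i 1 :: complex^'n) $ j))\<^sup>2)"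
      unfolding U(2) inner_unitary_conj using U(1) by (simp add: unitary_cancel)
    also have "\<dots> = (\<Sum>j\<in>UNIV. if j = i then d i else 0)"
      by (intro sum.cong) (auto simp: axis_def)
    also have "\<dots> = d i"
      by simp
    finally show ?thesis .
  qed
  then show ?thesis using that U by blast
qed

lemma unitary_conj_mult:
  assumes "unitary_matrix U"
  shows "(U ** diag_mat c ** conj_transpose U) ** (U ** diag_mat d ** conj_transpose U) =
    U ** diag_mat (\<lambda>i. c i * d i) ** conj_transpose U"
proof -
  have "(U ** diag_mat c ** conj_transpose U) ** (U ** diag_mat d ** conj_transpose U) =
    U ** diag_mat c ** (conj_transpose U ** U) ** diag_mat d ** conj_transpose U"
    by (simp add: matrix_mul_assoc)
  then show ?thesis
    using assms by (simp add: unitary_matrix_def flip: diag_mat_mult) (simp add: matrix_mul_assoc)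
qed

section \<open>Square roots and the absolute value of a matrix\<close>

text \<open>For \<open>D = S - T\<close> one has
  \<open>S ** D + D ** T = S ** S - T ** T = 0\<close>. On an eigenvector of \<open>D\<close> with
  nonzero eigenvalue the forms of \<open>S\<close> and \<open>T\<close> then add up to zero, so both
  vanish, and so does the form of \<open>D\<close>, a contradiction.\<close>

lemma psd_square_root_unique:
  assumes "psd S" "psd T" "S ** S = T ** T"
  shows "S = T"
proof -
  define D where "D = S - T"
  have "conj_transpose D = D"
    using assms by (simp add: D_def conj_transpose_diff psd_iff)
  then obtain U d where U: "unitary_matrix U" "D = U ** diag_mat d ** conj_transpose U"
    using hermitian_diagonalization by blast
  have "d i = 0" for i
  proof (rule ccontr)
    assume "d i \<noteq> 0"
    define x where "x = U *v axis i 1"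
    have "diag_mat d *v axis i 1 = d i *\<^sub>R axis i 1"
      by (simp add: vec_eq_iff diag_mat_vec axis_def scaleR_vec_component of_real_def)
    then have Dx: "D *v x = d i *\<^sub>R x"
      unfolding x_def U(2) using U(1)
      by (simp add: unitary_cancel matrix_vector_scaleR flip: matrix_vector_mul_assoc)
    have "S *v (D *v x) + D *v (T *v x) = 0"
      by (simp only: D_def matrix_vector_mult_diff_distrib matrix_vector_mult_diff_rdistrib)
        (simp add: matrix_vector_mul_assoc assms(3))
    then have "0 = x \<bullet> (S *v (D *v x) + D *v (T *v x))"
      by simp
    also have "\<dots> = d i * (x \<bullet> (S *v x) + x \<bullet> (T *v x))"
      using inner_adjoint[of D x "T *v x"] \<open>conj_transpose D = D\<close>
      by (simp add: inner_add_right Dx matrix_vector_scaleR distrib_left)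
    finally have "x \<bullet> (S *v x) + x \<bullet> (T *v x) = 0"
      using \<open>d i \<noteq> 0\<close> by simp
    then have "x \<bullet> (S *v x) = 0" "x \<bullet> (T *v x) = 0"
      using assms unfolding psd_iff by (smt (verit))+
    then have "x \<bullet> (D *v x) = 0"
      by (simp add: D_def matrix_vector_mult_diff_rdistrib inner_diff_right)
    then have "x = 0"
      using \<open>d i \<noteq> 0\<close> by (simp add: Dx)
    moreover have "norm x = 1"
      unfolding x_def using U by (simp add: unitary_norm)
    ultimately show False by simp
  qed
  then have "diag_mat d = 0"
    by (simp add: diag_mat_def vec_eq_iff)
  then have "D *v x = 0" for x
    unfolding U(2) by (simp flip: matrix_vector_mul_assoc)
  then show ?thesis
    by (metis D_def eq_iff_diff_eq_0 matrix_eq matrix_vector_mult_0)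
qed

lemma psd_conj_transpose_mult: "psd (conj_transpose T ** T)"
  by (simp add: psd_iff conj_transpose_mult inner_adjoint_right flip: matrix_vector_mul_assoc)

text \<open>Uniqueness of the root identifies the definite description in \<open>psd_sqrt\<close>
  with the explicit diagonal root, so the absolute value shares its eigenbasis with
  \<open>conj_transpose T ** T\<close>.\<close>

lemma matrix_abs_diagonalization:
  obtains U a where "unitary_matrix U" "\<And>i. 0 \<le> a i"
    "conj_transpose T ** T = U ** diag_mat (\<lambda>i. (a i)\<^sup>2) ** conj_transpose U"
    "matrix_abs T = U ** diag_mat a ** conj_transpose U"
proof -
  obtain U d where U: "unitary_matrix U" "\<And>i. 0 \<le> d i"
    and T: "conj_transpose T ** T = U ** diag_mat d ** conj_transpose U"
    using psd_diagonalization[OF psd_conj_transpose_mult] by metis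
  define a where "a = (\<lambda>i. sqrt (d i))"
  have a: "0 \<le> a i" "(a i)\<^sup>2 = d i" for i
    using U by (simp_all add: a_def)
  define S where "S = U ** diag_mat a ** conj_transpose U"
  have S: "psd S" "S ** S = conj_transpose T ** T"
    unfolding S_def using a
    by (simp_all add: psd_unitary_conj unitary_conj_mult U T flip: power2_eq_square)
  then have "matrix_abs T = S"
    unfolding matrix_abs_def psd_sqrt_def
    by (intro the_equality) (auto intro: psd_square_root_unique)
  then show ?thesis
    using that[of U a] a U T by (simp add: S_def)
qed

section \<open>Comparing singular values with eigenvalues\<close>

lemma finite_set_attains_max:
  fixes f :: "'a \<Rightarrow> real"
  assumes "finite I" "I \<noteq> {}"
  shows "\<exists>i\<in>I. \<forall>k\<in>I. f k \<le> f i"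
proof -
  have "Max (f ` I) \<in> f ` I"
    using assms by simp
  then obtain i where "i \<in> I" "f i = Max (f ` I)"
    by force
  then show ?thesis
    using assms by (intro bexI[of _ i]) simp_all
qed

text \<open>A comparison of decreasingly ordered sequences without sorting: a maximal index of
  \<open>a\<close> is matched with a maximal index of \<open>b\<close>, and the counting condition
  survives the removal of both.\<close>

lemma dominating_bijection:
  fixes a b :: "'n \<Rightarrow> real"
  assumes "finite I" "finite J" "card I = card J"
    and "\<And>t. card {i \<in> I. t \<le> a i} \<le> card {j \<in> J. t \<le> b j}"
  shows "\<exists>f. bij_betw f I J \<and> (\<forall>i\<in>I. a i \<le> b (f i))"
  using assms
proof (induction "card I" arbitrary: I J)
  case 0
  then show ?case by (auto simp: bij_betw_def)
next
  case (Suc n)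
  then have "I \<noteq> {}" "J \<noteq> {}" by auto
  obtain i where i: "i \<in> I" "\<And>k. k \<in> I \<Longrightarrow> a k \<le> a i"
    using finite_set_attains_max[of I a] Suc.prems \<open>I \<noteq> {}\<close> by blast
  obtain j where j: "j \<in> J" "\<And>k. k \<in> J \<Longrightarrow> b k \<le> b j"
    using finite_set_attains_max[of J b] Suc.prems \<open>J \<noteq> {}\<close> by blast
  have "a i \<le> b j"
  proof -
    have "0 < card {k \<in> I. a i \<le> a k}"
      using i Suc.prems by (auto simp: card_gt_0_iff)
    then have "0 < card {k \<in> J. a i \<le> b k}"
      using Suc.prems(4)[of "a i"] by linarith
    then obtain k where "k \<in> J" "a i \<le> b k"
      by (auto simp: card_gt_0_iff)
    then show ?thesis using j by fastforce
  qed
  \<comment> \<open>Up to the level \<open>a i\<close> both sets lose exactly one element; above it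
    the left set is empty.\<close>
  have "card {k \<in> I - {i}. t \<le> a k} \<le> card {k \<in> J - {j}. t \<le> b k}" for t
  proof (cases "t \<le> a i")
    case True
    have "{k \<in> I - {i}. t \<le> a k} = {k \<in> I. t \<le> a k} - {i}"
      "{k \<in> J - {j}. t \<le> b k} = {k \<in> J. t \<le> b k} - {j}" by auto
    then show ?thesis
      using Suc.prems(1,2) Suc.prems(4)[of t] True i j \<open>a i \<le> b j\<close> by simp
  next
    case False
    then have "{k \<in> I - {i}. t \<le> a k} = {}" using i by fastforce
    then show ?thesis by (metis card.empty le0)
  qed
  moreover have "n = card (I - {i})" "card (I - {i}) = card (J - {j})"
    using Suc.prems(1-3) Suc.hyps(2) i(1) j(1) by simp_all
  ultimately obtain f where f: "bij_betw f (I - {i}) (J - {j})" "\<forall>k\<in>I - {i}. a k \<le> b (f k)"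
    using Suc.hyps(1)[of "I - {i}" "J - {j}"] Suc.prems(1,2) by blast
  have "bij_betw (f(i := j)) I J"
  proof -
    have "inj_on (f(i := j)) I"
      using f(1) unfolding bij_betw_def inj_on_def by (metis DiffD2 DiffI fun_upd_apply imageI singleton_iff)
    moreover have "(f(i := j)) ` I = insert j (f ` (I - {i}))"
      using i(1) by auto
    ultimately show ?thesis
      using f(1) j(1) by (simp add: bij_betw_def insert_absorb)
  qed
  moreover have "\<forall>k\<in>I. a k \<le> b ((f(i := j)) k)"
    using f(2) \<open>a i \<le> b j\<close> by auto
  ultimately show ?case by blast
qed

lemma unitary_conj_entry:
  "(U ** diag_mat d ** conj_transpose U) $ r $ s =
    (\<Sum>i\<in>UNIV. complex_of_real (d i) * (U $ r $ i * cnj (U $ s $ i)))"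
proof -
  have "(U ** diag_mat d) $ r $ i = complex_of_real (d i) * U $ r $ i" for i
  proof -
    have "(U ** diag_mat d) $ r $ i = (\<Sum>k\<in>UNIV. if k = i then U $ r $ i * complex_of_real (d i) else 0)"
      unfolding matrix_matrix_mult_def diag_mat_def vec_lambda_beta by (rule sum.cong) auto
    then show ?thesis by (simp add: mult.commute)
  qed
  then show ?thesis
    by (simp add: matrix_matrix_mult_def[of "U ** diag_mat d"] conj_transpose_def mult.assoc)
qed

text \<open>Permuting the columns of \<open>U\<close> permutes the diagonal entries. Unitarity of
  the permuted matrix is the same identity with all diagonal entries equal to 1.\<close>

lemma unitary_conj_reindex:
  fixes U :: "complex^'n^'n"
  assumes "unitary_matrix U" "bij f"
  obtains W where "unitary_matrix W"
    "U ** diag_mat d ** conj_transpose U = W ** diag_mat (d \<circ> f) ** conj_transpose W"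
proof -
  define W :: "complex^'n^'n" where "W = (\<chi> r i. U $ r $ f i)"
  have reindex: "U ** diag_mat e ** conj_transpose U = W ** diag_mat (e \<circ> f) ** conj_transpose W" for e
  proof -
    have "(\<Sum>i\<in>UNIV. complex_of_real (e i) * (U $ r $ i * cnj (U $ s $ i))) =
      (\<Sum>i\<in>UNIV. complex_of_real (e (f i)) * (U $ r $ f i * cnj (U $ s $ f i)))" for r s
      by (rule sum.reindex_bij_betw[OF \<open>bij f\<close>, symmetric])
    then show ?thesis
      unfolding vec_eq_iff by (auto simp: unitary_conj_entry W_def)
  qed
  have one: "diag_mat (\<lambda>_. 1) = (mat 1 :: complex^'n^'n)"
    by (simp add: diag_mat_def mat_def vec_eq_iff)
  have "W ** conj_transpose W = mat 1"
    using reindex[of "\<lambda>_. 1"] assms(1) by (simp add: one o_def unitary_matrix_def)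
  then have "unitary_matrix W"
    using unitary_matrix_iff[of "conj_transpose W"] unitary_conj_transpose by fastforce
  then show ?thesis
    using that reindex by blast
qed

text \<open>A minimax criterion. At each level \<open>t\<close> the set \<open>K\<close> separates
  two counts: \<open>card K\<close> linear conditions force \<open>Z\<close> below \<open>t\<close>,
  so at most \<open>card K\<close> singular values reach \<open>t\<close>; and the form of
  \<open>M\<close> is at least \<open>t\<close> on a space of dimension \<open>card K\<close>, so at
  least that many eigenvalues reach \<open>t\<close>. \<open>Z\<close> may be the adjoint because it
  has the same singular values, and \<open>R\<close> lets the conditions be imposed on an image of
  \<open>h\<close>.\<close>

lemma matrix_abs_dominated:
  fixes T M :: "complex^'n^'n"
  assumes "psd M" and Z: "Z = T \<or> Z = conj_transpose T"
    and thr: "\<And>t. 0 < t \<Longrightarrow> \<exists>U K R. unitary_matrix U \<and>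
      (\<forall>h. h \<noteq> 0 \<longrightarrow> (\<forall>k\<in>K. (conj_transpose U *v (R *v h)) $ k = 0) \<longrightarrow> norm (Z *v h) < t * norm h) \<and>
      (\<forall>x. (\<forall>k. k \<notin> K \<longrightarrow> x $ k = 0) \<longrightarrow> t * (norm x)\<^sup>2 \<le> (U *v x) \<bullet> (M *v (U *v x)))"
  shows "\<exists>V. unitary_matrix V \<and> matrix_abs T \<le>\<^sub>L V ** M ** conj_transpose V"
proof -
  obtain U1 a where U1: "unitary_matrix U1" and a: "\<And>i. 0 \<le> a i"
    and TT: "conj_transpose T ** T = U1 ** diag_mat (\<lambda>i. (a i)\<^sup>2) ** conj_transpose U1"
    and absT: "matrix_abs T = U1 ** diag_mat a ** conj_transpose U1"
    using matrix_abs_diagonalization[of T] by metis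
  obtain U2 b where U2: "unitary_matrix U2" and M: "M = U2 ** diag_mat b ** conj_transpose U2"
    and b: "\<And>i. 0 \<le> b i"
    using psd_diagonalization[OF \<open>psd M\<close>] by metis
  have TU1: "conj_transpose T *v (T *v (U1 *v x)) = U1 *v (diag_mat (\<lambda>i. (a i)\<^sup>2) *v x)" for x
  proof -
    have "conj_transpose T *v (T *v (U1 *v x)) = (conj_transpose T ** T) *v (U1 *v x)"
      by (simp only: matrix_vector_mul_assoc matrix_mul_assoc)
    then show ?thesis
      unfolding TT using U1 by (simp add: unitary_cancel flip: matrix_vector_mul_assoc)
  qed
  have normT: "(norm (T *v (U1 *v x)))\<^sup>2 = (\<Sum>i\<in>UNIV. (a i)\<^sup>2 * (cmod (x $ i))\<^sup>2)" for x
  proof -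
    have "(norm (T *v (U1 *v x)))\<^sup>2 = (U1 *v x) \<bullet> (conj_transpose T *v (T *v (U1 *v x)))"
      by (simp add: power2_norm_eq_inner inner_adjoint_right)
    also have "\<dots> = x \<bullet> (diag_mat (\<lambda>i. (a i)\<^sup>2) *v x)"
      unfolding TU1 using U1 by (simp add: unitary_cancel flip: inner_adjoint)
    finally show ?thesis
      by (simp add: inner_diag_mat)
  qed
  have "card {i \<in> UNIV. t \<le> a i} \<le> card {i \<in> UNIV. t \<le> b i}" for t
  proof (cases "t \<le> 0")
    case True
    then have "{i \<in> UNIV. t \<le> a i} = UNIV" "{i \<in> UNIV. t \<le> b i} = UNIV"
      using a b by (auto intro: order_trans)
    then show ?thesis by simp
  next
    case False
    define I J where "I = {i. t \<le> a i}" and "J = {i. t \<le> b i}"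
    obtain U K R where U: "unitary_matrix U"
      and up: "\<And>h. h \<noteq> 0 \<Longrightarrow> (\<And>k. k \<in> K \<Longrightarrow> (conj_transpose U *v (R *v h)) $ k = 0) \<Longrightarrow>
        norm (Z *v h) < t * norm h"
      and lo: "\<And>x. (\<And>k. k \<notin> K \<Longrightarrow> x $ k = 0) \<Longrightarrow> t * (norm x)\<^sup>2 \<le> (U *v x) \<bullet> (M *v (U *v x))"
      using thr[of t] False by (metis not_le)
    \<comment> \<open>The weight \<open>c\<close> is 1 when \<open>Z = T\<close>, and the square of
      \<open>a\<close> when \<open>Z\<close> is the adjoint.\<close>
    have big: "t\<^sup>2 * c i * (cmod (x $ i))\<^sup>2 \<le> (a i)\<^sup>2 * c i * (cmod (x $ i))\<^sup>2"
      if "\<And>i. i \<notin> I \<Longrightarrow> x $ i = 0" "\<And>i. 0 \<le> c i" for x :: "complex^'n" and c i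
    proof (cases "i \<in> I")
      case True
      then have "t\<^sup>2 \<le> (a i)\<^sup>2"
        using False by (intro power_mono) (auto simp: I_def)
      then show ?thesis
        using that by (intro mult_right_mono) auto
    qed (simp add: that)
    have "card I \<le> card K"
    proof (rule ccontr)
      assume "\<not> card I \<le> card K"
      \<comment> \<open>The test vector \<open>h\<close> is a combination of right singular vectors
        \<open>U1 *v x\<close> if \<open>Z = T\<close>, and its image under \<open>T\<close> if
        \<open>Z\<close> is the adjoint, so that \<open>Z *v h\<close> is again diagonal in the
        basis \<open>U1\<close>.\<close>
      define N where "N = (if Z = T then mat 1 else T)"
      define m where "m = conj_transpose U ** R ** N ** U1"
      obtain x where "x \<noteq> 0" and supp: "\<And>i. i \<notin> I \<Longrightarrow> x $ i = 0"
        and mx: "\<And>k. k \<in> K \<Longrightarrow> (\<Sum>i\<in>UNIV. m $ k $ i * x $ i) = 0"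
        using homogeneous_system_nontrivial_solution[of K I "($) m"] \<open>\<not> card I \<le> card K\<close>
        by (metis not_le)
      define h where "h = N *v (U1 *v x)"
      have "(conj_transpose U *v (R *v h)) $ k = 0" if "k \<in> K" for k
      proof -
        have "conj_transpose U *v (R *v h) = m *v x"
          by (simp add: h_def m_def matrix_vector_mul_assoc matrix_mul_assoc)
        then show ?thesis
          using mx[OF that] by (simp add: matrix_vector_mult_def)
      qed
      moreover have normTx: "t * norm x \<le> norm (T *v (U1 *v x))"
      proof -
        have "(t * norm x)\<^sup>2 \<le> (norm (T *v (U1 *v x)))\<^sup>2"
          unfolding normT power_mult_distrib norm_vec_cmod[of x] sum_distrib_left
          using big[where x = x and c = "\<lambda>_. 1", OF supp] by (intro sum_mono) simp
        then show ?thesis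
          by (rule power2_le_imp_le) simp
      qed
      have "h \<noteq> 0 \<and> t * norm h \<le> norm (Z *v h)"
      proof (cases "Z = T")
        case True
        have nh: "norm h = norm x"
          using U1 by (simp add: h_def N_def True unitary_norm)
        then have "h \<noteq> 0"
          using \<open>x \<noteq> 0\<close> by auto
        then show ?thesis
          using normTx nh by (simp add: h_def N_def True)
      next
        case ZT: False
        then have h: "h = T *v (U1 *v x)"
          by (simp add: h_def N_def)
        have "norm h > 0"
          using normTx \<open>x \<noteq> 0\<close> False by (smt (verit) h mult_pos_pos zero_less_norm_iff)
        moreover have "(t * norm h)\<^sup>2 \<le> (norm (Z *v h))\<^sup>2"
        proof -
          have "Z *v h = U1 *v (diag_mat (\<lambda>i. (a i)\<^sup>2) *v x)"
            using Z ZT TU1 by (simp add: h)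
          then have "(norm (Z *v h))\<^sup>2 = (\<Sum>i\<in>UNIV. ((a i)\<^sup>2)\<^sup>2 * (cmod (x $ i))\<^sup>2)"
            using U1 by (simp only: unitary_norm norm_diag_mat)
          then have "(norm (Z *v h))\<^sup>2 = (\<Sum>i\<in>UNIV. (a i)\<^sup>2 * (a i)\<^sup>2 * (cmod (x $ i))\<^sup>2)"
            by (simp only: power2_eq_square[of "(a _)\<^sup>2"])
          moreover have "(t * norm h)\<^sup>2 = (\<Sum>i\<in>UNIV. t\<^sup>2 * (a i)\<^sup>2 * (cmod (x $ i))\<^sup>2)"
            unfolding h power_mult_distrib normT by (simp add: sum_distrib_left mult.assoc)
          ultimately show ?thesis
            using big[where x = x and c = "\<lambda>i. (a i)\<^sup>2", OF supp] by (auto intro: sum_mono)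
        qed
        then have "t * norm h \<le> norm (Z *v h)"
          by (rule power2_le_imp_le) simp
        ultimately show ?thesis by auto
      qed
      ultimately show False
        using up[of h] by force
    qed
    also have "card K \<le> card J"
    proof (rule ccontr)
      assume "\<not> card K \<le> card J"
      \<comment> \<open>The vector \<open>U *v x\<close> obtained from this system is orthogonal to
        all eigenvectors of \<open>M\<close> with eigenvalue at least \<open>t\<close>, so its form
        lies strictly below the level that \<open>lo\<close> guarantees.\<close>
      define m where "m = conj_transpose U2 ** U"
      obtain x where "x \<noteq> 0" and supp: "\<And>i. i \<notin> K \<Longrightarrow> x $ i = 0"
        and mx: "\<And>k. k \<in> J \<Longrightarrow> (\<Sum>i\<in>UNIV. m $ k $ i * x $ i) = 0"
        using homogeneous_system_nontrivial_solution[of J K "($) m"] \<open>\<not> card K \<le> card J\<close>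
        by (metis not_le)
      define w where "w = conj_transpose U2 *v (U *v x)"
      have wJ: "w $ k = 0" if "k \<in> J" for k
        using mx[OF that] by (simp add: w_def m_def matrix_vector_mul_assoc) 
          (simp add: matrix_vector_mult_def)
      have nw: "norm w = norm x"
        using U U2 by (simp add: w_def unitary_norm)
      then obtain k where "w $ k \<noteq> 0"
        using \<open>x \<noteq> 0\<close> by (metis norm_eq_zero vec_eq_iff zero_index)
      have "(U *v x) \<bullet> (M *v (U *v x)) = (\<Sum>i\<in>UNIV. b i * (cmod (w $ i))\<^sup>2)"
        unfolding M inner_unitary_conj w_def ..
      also have "\<dots> < (\<Sum>i\<in>UNIV. t * (cmod (w $ i))\<^sup>2)"
      proof (rule sum_strict_mono_ex1)
        have "b i * (cmod (w $ i))\<^sup>2 \<le> t * (cmod (w $ i))\<^sup>2" for i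
          using wJ[of i] by (cases "i \<in> J") (auto simp: J_def intro: mult_right_mono)
        then show "\<forall>i\<in>UNIV. b i * (cmod (w $ i))\<^sup>2 \<le> t * (cmod (w $ i))\<^sup>2" by blast
        have "b k < t"
          using wJ[of k] \<open>w $ k \<noteq> 0\<close> unfolding J_def by (metis mem_Collect_eq not_le)
        then have "b k * (cmod (w $ k))\<^sup>2 < t * (cmod (w $ k))\<^sup>2"
          using \<open>w $ k \<noteq> 0\<close> by (intro mult_strict_right_mono) auto
        then show "\<exists>i\<in>UNIV. b i * (cmod (w $ i))\<^sup>2 < t * (cmod (w $ i))\<^sup>2" by blast
      qed simp
      also have "\<dots> = t * (norm x)\<^sup>2"
        by (simp add: norm_vec_cmod sum_distrib_left flip: nw)
      finally show False
        using lo[OF supp] by force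
    qed
    finally show ?thesis by (simp add: I_def J_def)
  qed
  then obtain f where f: "bij_betw f UNIV UNIV" "\<And>i. a i \<le> b (f i)"
    using dominating_bijection[of "UNIV :: 'n set" "UNIV :: 'n set" a b] by auto
  obtain W where W: "unitary_matrix W" "M = W ** diag_mat (b \<circ> f) ** conj_transpose W"
    using unitary_conj_reindex[OF U2 f(1)] M by metis
  \<comment> \<open>\<open>V\<close> carries the permuted eigenbasis of \<open>M\<close> to that of
    \<open>matrix_abs T\<close>, which reduces the Loewner inequality to one between diagonal
    entries.\<close>
  define V where "V = U1 ** conj_transpose W"
  have "V ** M ** conj_transpose V = U1 ** (conj_transpose W ** W) ** diag_mat (b \<circ> f) **
      (conj_transpose W ** W) ** conj_transpose U1"
    unfolding V_def W(2) conj_transpose_mult conj_transpose_conj_transpose matrix_mul_assoc ..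
  then have VM: "V ** M ** conj_transpose V = U1 ** diag_mat (b \<circ> f) ** conj_transpose U1"
    using W(1) by (simp add: unitary_matrix_def)
  have "psd (V ** M ** conj_transpose V - matrix_abs T)"
    unfolding VM absT psd_iff matrix_vector_mult_diff_rdistrib inner_diff_right inner_unitary_conj
      sum_subtractf[symmetric]
    using f(2) by (auto simp: conj_transpose_diff conj_transpose_mult matrix_mul_assoc
        mult_right_mono intro!: sum_nonneg)
  moreover have "unitary_matrix V"
    unfolding V_def using U1 W unitary_mult unitary_conj_transpose by blast
  ultimately show ?thesis
    unfolding loewner_le_def by blast
qed

section \<open>Power-like families of matrices\<close>

text \<open>Scalar counterpart of \<open>pos_power\<close>, with value 1 at exponent 0 even for
  \<open>t = 0\<close>.\<close>

definition rpow :: "real \<Rightarrow> real \<Rightarrow> real" where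
  "rpow t s = (if s = 0 then 1 else t powr s)"

text \<open>The tangent line at \<open>y\<close> lies above a concave power and below a convex one.
  The first case is the weighted Young inequality for \<open>w\<close> and \<open>y\<close>, the
  second the same inequality with weight \<open>1 / \<theta>\<close> for their powers.\<close>

lemma powr_tangent:
  fixes w y \<theta> :: real
  assumes "0 \<le> w" "0 < y" "0 < \<theta>"
  shows "\<theta> \<le> 1 \<Longrightarrow> w powr \<theta> \<le> \<theta> * y powr (\<theta> - 1) * w + (1 - \<theta>) * y powr \<theta>"
    and "1 \<le> \<theta> \<Longrightarrow> \<theta> * y powr (\<theta> - 1) * w + (1 - \<theta>) * y powr \<theta> \<le> w powr \<theta>"
proof -
  have y: "y powr (\<theta> - 1) * y = y powr \<theta>" "y powr (\<theta> - 1) * y powr (1 - \<theta>) = 1"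
    using assms(2) powr_mult_base[of y "\<theta> - 1"] by (simp_all add: mult.commute flip: powr_add)
  show "w powr \<theta> \<le> \<theta> * y powr (\<theta> - 1) * w + (1 - \<theta>) * y powr \<theta>" if "\<theta> \<le> 1"
  proof (cases "w = 0")
    case False
    then have "w powr \<theta> * y powr (1 - \<theta>) \<le> \<theta> * w + (1 - \<theta>) * y"
      using Youngs_inequality_0[of \<theta> "1 - \<theta>" w y] assms that by simp
    then have "y powr (\<theta> - 1) * (w powr \<theta> * y powr (1 - \<theta>)) \<le> y powr (\<theta> - 1) * (\<theta> * w + (1 - \<theta>) * y)"
      by (rule mult_left_mono) simp
    moreover have "y powr (\<theta> - 1) * (w powr \<theta> * y powr (1 - \<theta>)) =
        w powr \<theta> * (y powr (\<theta> - 1) * y powr (1 - \<theta>))"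
      by (simp add: mult_ac)
    moreover have "y powr (\<theta> - 1) * (\<theta> * w + (1 - \<theta>) * y) =
        \<theta> * y powr (\<theta> - 1) * w + (1 - \<theta>) * (y powr (\<theta> - 1) * y)"
      by (simp add: algebra_simps)
    ultimately show ?thesis
      unfolding y by simp
  qed (use assms that in simp)
  show "\<theta> * y powr (\<theta> - 1) * w + (1 - \<theta>) * y powr \<theta> \<le> w powr \<theta>" if "1 \<le> \<theta>"
  proof (cases "w = 0")
    case True
    then show ?thesis
      using that by (simp add: mult_nonpos_nonneg)
  next
    case False
    have "(w powr \<theta>) powr (1 / \<theta>) * (y powr \<theta>) powr (1 - 1 / \<theta>) \<le>
        1 / \<theta> * w powr \<theta> + (1 - 1 / \<theta>) * y powr \<theta>"
      using assms that False by (intro Youngs_inequality_0) auto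
    moreover have "(w powr \<theta>) powr (1 / \<theta>) = w" "(y powr \<theta>) powr (1 - 1 / \<theta>) = y powr (\<theta> - 1)"
      using assms False that by (simp_all add: powr_powr right_diff_distrib)
    ultimately have "\<theta> * (w * y powr (\<theta> - 1)) \<le>
        \<theta> * (1 / \<theta> * w powr \<theta> + (1 - 1 / \<theta>) * y powr \<theta>)"
      using assms by (intro mult_left_mono) auto
    also have "\<dots> = w powr \<theta> + (\<theta> - 1) * y powr \<theta>"
      using assms by (simp add: field_simps)
    finally show ?thesis
      by (simp add: algebra_simps)
  qed
qed

text \<open>Substituting the \<open>q\<close>-th power of \<open>t\<close> for \<open>w\<close>
  turns the tangent line into a combination of that power and a constant, the shape that
  \<open>combination_nonneg\<close> transfers to matrices.\<close>

lemma rpow_tangent: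
  assumes "0 \<le> t" "0 < y" "0 \<le> u" "0 < q"
  shows "u \<le> q \<Longrightarrow> rpow t u \<le> u / q * y powr (u / q - 1) * rpow t q + (1 - u / q) * y powr (u / q)"
    and "q \<le> u \<Longrightarrow> u / q * y powr (u / q - 1) * rpow t q + (1 - u / q) * y powr (u / q) \<le> rpow t u"
proof -
  show "rpow t u \<le> u / q * y powr (u / q - 1) * rpow t q + (1 - u / q) * y powr (u / q)" if "u \<le> q"
  proof (cases "u = 0")
    case False
    then show ?thesis
      using powr_tangent(1)[of "t powr q" y "u / q"] assms that by (simp add: rpow_def powr_powr)
  qed (use assms in \<open>simp add: rpow_def\<close>)
  show "u / q * y powr (u / q - 1) * rpow t q + (1 - u / q) * y powr (u / q) \<le> rpow t u" if "q \<le> u"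
    using powr_tangent(2)[of "t powr q" y "u / q"] assms that by (simp add: rpow_def powr_powr)
qed

text \<open>The point is that \<open>g \<bullet> (Z *v g) \<le> z * (norm g)\<^sup>2\<close> is only needed for
  the vector \<open>g = Z *v h\<close>, for which Cauchy-Schwarz turns it into a norm bound.\<close>

lemma triple_product_norm_less:
  assumes "psd Z" and "0 < x" "0 < y" "0 < z"
    and X: "\<And>f. f \<in> E \<Longrightarrow> norm (X *v f) \<le> x * norm f"
    and Y: "\<And>g. g \<in> E \<Longrightarrow> g \<noteq> 0 \<Longrightarrow> Y *v g \<in> E \<and> norm (Y *v g) < y * norm g"
    and Z: "\<And>g. g \<in> E \<Longrightarrow> g \<bullet> (Z *v g) \<le> z * (norm g)\<^sup>2"
    and h: "Z *v h \<in> E" "h \<noteq> 0"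
  shows "norm ((X ** Y ** Z) *v h) < x * y * z * norm h"
proof -
  define g where "g = Z *v h"
  have XYZ: "(X ** Y ** Z) *v h = X *v (Y *v g)"
    by (simp only: g_def matrix_vector_mul_assoc matrix_mul_assoc)
  show ?thesis
  proof (cases "g = 0")
    case True
    then show ?thesis
      using assms by (simp add: XYZ)
  next
    case False
    have "(norm g)\<^sup>2 * (norm g)\<^sup>2 = (g \<bullet> (Z *v h))\<^sup>2"
      unfolding g_def[symmetric] power2_norm_eq_inner by (simp only: power2_eq_square)
    also have "\<dots> \<le> (g \<bullet> (Z *v g)) * (h \<bullet> (Z *v h))"
      by (rule psd_Cauchy_Schwarz) fact
    also have "\<dots> \<le> (z * (norm g)\<^sup>2) * (norm h * norm g)"
      using \<open>psd Z\<close> Z[of g] h norm_cauchy_schwarz[of h g] assms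
      by (intro mult_mono) (auto simp: g_def psd_iff)
    finally have "(norm g)\<^sup>2 * norm g * norm g \<le> (norm g)\<^sup>2 * norm g * (z * norm h)"
      by (simp add: power2_eq_square mult_ac)
    then have g: "norm g \<le> z * norm h"
      using False by (subst (asm) mult_le_cancel_left_pos) auto
    have "norm (X *v (Y *v g)) \<le> x * norm (Y *v g)"
      using X Y h False by (simp add: g_def)
    also have "\<dots> < x * (y * norm g)"
      using Y h False \<open>0 < x\<close> by (simp add: g_def)
    also have "\<dots> \<le> x * (y * (z * norm h))"
      using g assms by simp
    finally show ?thesis
      by (simp add: XYZ mult.assoc)
  qed
qed

section \<open>Abstract power families and the singular value estimate\<close>

text \<open>Collects what is used of the matrices \<Phi>(A^s). In \<open>combination_nonneg\<close>
  the constant is paired with \<open>S 0\<close>, not with the unit matrix, because the map is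
  merely sub-unital.\<close>

locale power_family =
  fixes S :: "real \<Rightarrow> complex^'n^'n"
  assumes psd: "0 \<le> s \<Longrightarrow> psd (S s)"
    and combination_nonneg: "\<lbrakk>0 \<le> u; 0 \<le> v; \<And>t. 0 \<le> t \<Longrightarrow> 0 \<le> a * rpow t u + b * rpow t v + c\<rbrakk> \<Longrightarrow>
      0 \<le> a * (h \<bullet> (S u *v h)) + b * (h \<bullet> (S v *v h)) + c * (h \<bullet> (S 0 *v h))"
    and sub_unit: "h \<bullet> (S 0 *v h) \<le> (norm h)\<^sup>2"
    and Kadison: "0 \<le> s \<Longrightarrow> (norm (S s *v h))\<^sup>2 \<le> h \<bullet> (S (2 * s) *v h)"
begin

text \<open>The tangent inequality is evaluated at the single vector \<open>g\<close>. The
  coefficients of \<open>S q\<close> and \<open>S 0\<close> are nonnegative, so the bound on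
  \<open>S q\<close> and \<open>sub_unit\<close> may be inserted.\<close>

lemma upper_bound:
  assumes "0 \<le> u" "u \<le> q" "0 < y" "g \<bullet> (S q *v g) \<le> y * (norm g)\<^sup>2"
  shows "g \<bullet> (S u *v g) \<le> y powr (u / q) * (norm g)\<^sup>2"
proof (cases "q = 0")
  \<comment> \<open>Here \<open>u = 0\<close> as well, and \<open>u / q\<close> is 0 by the
    convention for division by zero, so the claim is \<open>sub_unit\<close>.\<close>
  case True
  then show ?thesis
    using assms sub_unit by simp
next
  case False
  define \<theta> where "\<theta> = u / q"
  have \<theta>: "0 \<le> \<theta>" "\<theta> \<le> 1"
    using assms False by (auto simp: \<theta>_def divide_le_eq)
  have "0 \<le> (-1) * rpow t u + \<theta> * y powr (\<theta> - 1) * rpow t q + (1 - \<theta>) * y powr \<theta>" if "0 \<le> t" for t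
    using rpow_tangent(1)[of t y u q] assms that False unfolding \<theta>_def by simp
  then have "0 \<le> (-1) * (g \<bullet> (S u *v g)) + \<theta> * y powr (\<theta> - 1) * (g \<bullet> (S q *v g)) +
      (1 - \<theta>) * y powr \<theta> * (g \<bullet> (S 0 *v g))"
    using assms by (intro combination_nonneg) auto
  also have "\<dots> \<le> (-1) * (g \<bullet> (S u *v g)) + \<theta> * y powr (\<theta> - 1) * (y * (norm g)\<^sup>2) +
      (1 - \<theta>) * y powr \<theta> * (norm g)\<^sup>2"
    using \<theta> assms(4) sub_unit by (intro add_mono mult_left_mono order_refl) auto
  also have "y powr (\<theta> - 1) * y = y powr \<theta>"
    using assms(3) powr_mult_base[of y "\<theta> - 1"] by (simp add: mult.commute)
  then have "\<theta> * y powr (\<theta> - 1) * (y * (norm g)\<^sup>2) = \<theta> * y powr \<theta> * (norm g)\<^sup>2"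
    by simp
  finally show ?thesis
    by (simp add: \<theta>_def algebra_simps)
qed

text \<open>The tangent at \<open>y\<close> has constant term with factor
  \<open>1 - \<theta>\<close>, which is not positive when \<open>\<theta>\<close> is at least 1, so
  replacing \<open>S 0\<close> by the unit again works in the required direction.\<close>

lemma lower_bound:
  assumes "q \<le> u" "0 < q" "0 < y" "y * (norm g)\<^sup>2 \<le> g \<bullet> (S q *v g)"
  shows "y powr (u / q) * (norm g)\<^sup>2 \<le> g \<bullet> (S u *v g)"
proof -
  define \<theta> where "\<theta> = u / q"
  have \<theta>: "1 \<le> \<theta>"
    using assms by (auto simp: \<theta>_def le_divide_eq)
  have "0 \<le> 1 * rpow t u + (- \<theta> * y powr (\<theta> - 1)) * rpow t q + (\<theta> - 1) * y powr \<theta>" if "0 \<le> t" for t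
    using rpow_tangent(2)[of t y u q] assms that unfolding \<theta>_def by (simp add: algebra_simps)
  then have "0 \<le> 1 * (g \<bullet> (S u *v g)) + (- \<theta> * y powr (\<theta> - 1)) * (g \<bullet> (S q *v g)) +
      (\<theta> - 1) * y powr \<theta> * (g \<bullet> (S 0 *v g))"
    using assms by (intro combination_nonneg) auto
  also have "\<dots> \<le> 1 * (g \<bullet> (S u *v g)) + (- \<theta> * y powr (\<theta> - 1)) * (y * (norm g)\<^sup>2) +
      (\<theta> - 1) * y powr \<theta> * (norm g)\<^sup>2"
    using \<theta> assms(4) sub_unit by (intro add_mono mult_left_mono mult_left_mono_neg order_refl) auto
  also have "y powr (\<theta> - 1) * y = y powr \<theta>"
    using assms(3) powr_mult_base[of y "\<theta> - 1"] by (simp add: mult.commute)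
  then have "(- \<theta> * y powr (\<theta> - 1)) * (y * (norm g)\<^sup>2) = - \<theta> * y powr \<theta> * (norm g)\<^sup>2"
    by simp
  finally show ?thesis
    by (simp add: \<theta>_def algebra_simps)
qed

text \<open>Supplies the level condition of \<open>matrix_abs_dominated\<close>. The witnesses are
  an eigenbasis \<open>U\<close> of \<open>S q\<close>, the indices \<open>K\<close> of its
  eigenvalues that are at least \<open>y\<close>, and \<open>R = S r\<close>.\<close>

lemma product_threshold:
  assumes "0 \<le> p" "2 * p \<le> q" "0 \<le> r" "r \<le> q" "0 < t"
  shows "\<exists>U K R. unitary_matrix U \<and>
    (\<forall>h. h \<noteq> 0 \<longrightarrow> (\<forall>k\<in>K. (conj_transpose U *v (R *v h)) $ k = 0) \<longrightarrow>
      norm ((S p ** S q ** S r) *v h) < t * norm h) \<and>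
    (\<forall>x. (\<forall>k. k \<notin> K \<longrightarrow> x $ k = 0) \<longrightarrow> t * (norm x)\<^sup>2 \<le> (U *v x) \<bullet> (S (p + q + r) *v (U *v x)))"
proof -
  \<comment> \<open>The cut for the eigenvalues of \<open>S q\<close>: with \<open>t\<close> written
    as \<beta>^(p+q+r) it is \<beta>^q. If \<open>q = 0\<close> then \<open>p\<close> and
    \<open>r\<close> vanish too, and the cut is \<open>t\<close> itself.\<close>
  define y where "y = (if q = 0 then t else t powr (q / (p + q + r)))"
  have y: "0 < y"
    using assms by (simp add: y_def)
  have yq: "y powr ((p + q + r) / q) = t" if "q \<noteq> 0"
    using assms that by (simp add: y_def powr_powr)
  have q: "0 \<le> q"
    using assms by simp
  have prod: "y powr (p / q) * y * y powr (r / q) = t"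
  proof (cases "q = 0")
    case True
    then show ?thesis using assms by (simp add: y_def)
  next
    case False
    then have "y powr (p / q) * y * y powr (r / q) = y powr (p / q) * y powr (q / q) * y powr (r / q)"
      using y by simp
    also have "\<dots> = y powr ((p + q + r) / q)"
      by (simp only: add_divide_distrib powr_add)
    finally show ?thesis
      using yq False by simp
  qed
  obtain U c where U: "unitary_matrix U" and Sq: "S q = U ** diag_mat c ** conj_transpose U"
    and c: "\<And>i. 0 \<le> c i"
    using psd_diagonalization[OF psd[OF q]] by metis
  define K where "K = {k. y \<le> c k}"
  define E where "E = {g. \<forall>k\<in>K. (conj_transpose U *v g) $ k = 0}"
  have less_y: "c k < y" if "g \<in> E" "(conj_transpose U *v g) $ k \<noteq> 0" for g k
    using that by (auto simp: E_def K_def not_le)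
  have q_form: "g \<bullet> (S q *v g) \<le> y * (norm g)\<^sup>2" if "g \<in> E" for g
  proof -
    have "c i * (cmod ((conj_transpose U *v g) $ i))\<^sup>2 \<le> y * (cmod ((conj_transpose U *v g) $ i))\<^sup>2" for i
      using less_y[OF that, of i]
      by (cases "(conj_transpose U *v g) $ i = 0") (auto intro: mult_right_mono)
    then have "g \<bullet> (S q *v g) \<le> y * (norm (conj_transpose U *v g))\<^sup>2"
      unfolding Sq inner_unitary_conj norm_vec_cmod sum_distrib_left by (intro sum_mono)
    then show ?thesis
      using U by (simp add: unitary_norm)
  qed
  \<comment> \<open>\<open>E\<close> is spanned by eigenvectors of \<open>S q\<close>, hence
    invariant. Strictness comes from a nonzero coordinate of \<open>g\<close>, whose eigenvalue is
    strictly below \<open>y\<close>.\<close>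
  have Sq_E: "S q *v g \<in> E \<and> norm (S q *v g) < y * norm g" if "g \<in> E" "g \<noteq> 0" for g
  proof -
    define w where "w = conj_transpose U *v g"
    have Uw: "conj_transpose U *v (S q *v g) = diag_mat c *v w"
      unfolding Sq w_def using U by (simp add: unitary_cancel flip: matrix_vector_mul_assoc)
    have nw: "norm w = norm g"
      using U by (simp add: w_def unitary_norm)
    then obtain k where k: "w $ k \<noteq> 0"
      using \<open>g \<noteq> 0\<close> by (metis norm_eq_zero vec_eq_iff zero_index)
    have less: "(c i)\<^sup>2 * (cmod (w $ i))\<^sup>2 < y\<^sup>2 * (cmod (w $ i))\<^sup>2" if "w $ i \<noteq> 0" for i
      using less_y[OF \<open>g \<in> E\<close>, of i] that c
      by (intro mult_strict_right_mono power_strict_mono) (auto simp: w_def)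
    have "(norm (S q *v g))\<^sup>2 = (norm (diag_mat c *v w))\<^sup>2"
      using U by (metis Uw unitary_norm(2))
    also have "\<dots> = (\<Sum>i\<in>UNIV. (c i)\<^sup>2 * (cmod (w $ i))\<^sup>2)"
      by (rule norm_diag_mat)
    also have "\<dots> < (\<Sum>i\<in>UNIV. y\<^sup>2 * (cmod (w $ i))\<^sup>2)"
    proof (rule sum_strict_mono_ex1)
      show "\<forall>i\<in>UNIV. (c i)\<^sup>2 * (cmod (w $ i))\<^sup>2 \<le> y\<^sup>2 * (cmod (w $ i))\<^sup>2"
        using less by (metis less_imp_le mult_zero_right norm_zero order_refl zero_power2)
      show "\<exists>i\<in>UNIV. (c i)\<^sup>2 * (cmod (w $ i))\<^sup>2 < y\<^sup>2 * (cmod (w $ i))\<^sup>2"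
        using less k by blast
    qed simp
    also have "\<dots> = (y * norm g)\<^sup>2"
      by (simp add: power_mult_distrib norm_vec_cmod sum_distrib_left flip: nw)
    finally have "norm (S q *v g) < y * norm g"
      by (rule power2_less_imp_less) (use y in auto)
    moreover have "S q *v g \<in> E"
      using \<open>g \<in> E\<close> by (simp add: E_def Uw diag_mat_vec) (simp add: w_def)
    ultimately show ?thesis by blast
  qed
  \<comment> \<open>Kadison's inequality replaces the square of \<open>S p\<close> by
    \<open>S (2 * p)\<close>, and \<open>upper_bound\<close> applies to it because
    \<open>2 * p\<close> is at most \<open>q\<close>.\<close>
  have X: "norm (S p *v f) \<le> y powr (p / q) * norm f" if "f \<in> E" for f
  proof -
    have "(norm (S p *v f))\<^sup>2 \<le> f \<bullet> (S (2 * p) *v f)"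
      using assms by (intro Kadison)
    also have "\<dots> \<le> y powr (2 * p / q) * (norm f)\<^sup>2"
      using assms y q_form[OF that] by (intro upper_bound) auto
    also have "y powr (2 * p / q) = (y powr (p / q))\<^sup>2"
      by (simp add: power2_eq_square flip: powr_add)
    finally have "(norm (S p *v f))\<^sup>2 \<le> (y powr (p / q) * norm f)\<^sup>2"
      by (simp add: power_mult_distrib)
    then show ?thesis
      by (rule power2_le_imp_le) simp
  qed
  have up: "norm ((S p ** S q ** S r) *v h) < t * norm h"
    if "h \<noteq> 0" "\<forall>k\<in>K. (conj_transpose U *v (S r *v h)) $ k = 0" for h
    unfolding prod[symmetric]
  proof (rule triple_product_norm_less[where E = E])
    show "g \<bullet> (S r *v g) \<le> y powr (r / q) * (norm g)\<^sup>2" if "g \<in> E" for g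
      using assms y q_form[OF that] by (intro upper_bound) auto
    show "S r *v h \<in> E"
      using that by (simp add: E_def)
  qed (use assms y that X Sq_E psd in auto)
  moreover have lo: "t * (norm x)\<^sup>2 \<le> (U *v x) \<bullet> (S (p + q + r) *v (U *v x))"
    if "\<forall>k. k \<notin> K \<longrightarrow> x $ k = 0" for x
  proof -
    have nUx: "norm (U *v x) = norm x"
      using U by (simp add: unitary_norm)
    have "y * (cmod (x $ i))\<^sup>2 \<le> c i * (cmod (x $ i))\<^sup>2" for i
      using that by (cases "i \<in> K") (auto simp: K_def intro: mult_right_mono)
    then have "y * (norm x)\<^sup>2 \<le> (\<Sum>i\<in>UNIV. c i * (cmod (x $ i))\<^sup>2)"
      unfolding norm_vec_cmod sum_distrib_left by (intro sum_mono)
    also have "\<dots> = (U *v x) \<bullet> (S q *v (U *v x))"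
      unfolding Sq inner_unitary_conj using U by (simp add: unitary_cancel)
    finally have yx: "y * (norm (U *v x))\<^sup>2 \<le> (U *v x) \<bullet> (S q *v (U *v x))"
      by (simp add: nUx)
    show ?thesis
    proof (cases "q = 0")
      case True
      then show ?thesis
        using yx assms by (simp add: y_def nUx)
    next
      case False
      then have "y powr ((p + q + r) / q) * (norm (U *v x))\<^sup>2 \<le> (U *v x) \<bullet> (S (p + q + r) *v (U *v x))"
        using assms y yx by (intro lower_bound) auto
      then show ?thesis
        using yq[OF False] by (simp add: nUx)
    qed
  qed
  ultimately show ?thesis
    using U by blast
qed

theorem matrix_abs_product:
  assumes "0 \<le> p" "0 \<le> q" "0 \<le> r" "min p r \<le> q / 2" "max p r \<le> q"
  shows "\<exists>V. unitary_matrix V \<and>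
    matrix_abs (S p ** S q ** S r) \<le>\<^sub>L V ** S (p + q + r) ** conj_transpose V"
proof (cases "p \<le> q / 2")
  case True
  show ?thesis
  proof (rule matrix_abs_dominated)
    show "psd (S (p + q + r))"
      using assms by (intro psd) simp
  qed (use product_threshold[of p q r] True assms in auto)
next
  \<comment> \<open>Now \<open>r\<close> is at most \<open>q / 2\<close>, and the estimate is
    applied to the adjoint product, in which \<open>p\<close> and \<open>r\<close> have changed
    places.\<close>
  case False
  have herm: "conj_transpose (S s) = S s" if "0 \<le> s" for s
    using psd[OF that] by (simp add: psd_iff)
  show ?thesis
  proof (rule matrix_abs_dominated)
    show "psd (S (p + q + r))"
      using assms by (intro psd) simp
    show "S r ** S q ** S p = S p ** S q ** S r \<or>
        S r ** S q ** S p = conj_transpose (S p ** S q ** S r)"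
      using assms by (simp add: conj_transpose_mult herm matrix_mul_assoc)
    have eq: "r + q + p = p + q + r" by simp
    show "\<exists>U K R. unitary_matrix U \<and>
        (\<forall>h. h \<noteq> 0 \<longrightarrow> (\<forall>k\<in>K. (conj_transpose U *v (R *v h)) $ k = 0) \<longrightarrow>
          norm ((S r ** S q ** S p) *v h) < t * norm h) \<and>
        (\<forall>x. (\<forall>k. k \<notin> K \<longrightarrow> x $ k = 0) \<longrightarrow>
          t * (norm x)\<^sup>2 \<le> (U *v x) \<bullet> (S (p + q + r) *v (U *v x)))" if "0 < t" for t
      using product_threshold[of r q p t, unfolded eq] False assms that
      by (simp add: min_def split: if_splits)
  qed
qed

end

section \<open>Power families as limits of finite sums\<close>

lemma hermitian_polarization:
  fixes M :: "complex^'n^'n"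
  assumes "conj_transpose M = M"
  shows "x \<bullet> (M *v y) = ((x + y) \<bullet> (M *v (x + y)) - (x - y) \<bullet> (M *v (x - y))) / 4"
proof -
  have "y \<bullet> (M *v x) = x \<bullet> (M *v y)"
    using inner_adjoint[of M x y] assms by (simp add: inner_commute)
  then show ?thesis
    by (simp add: matrix_vector_right_distrib matrix_vector_mult_diff_distrib inner_add_left
        inner_add_right inner_diff_left inner_diff_right)
qed

text \<open>Each axiom holds for the approximating sums because the \<open>C n k\<close> are
  positive semidefinite, and is preserved by limits of quadratic forms. Kadison's inequality comes
  from the nonnegative forms of \<open>C n k\<close> at
  \<open>y - rpow (x n k) s *\<^sub>R h\<close>, so multiplicativity is needed for scalars
  alone.\<close>

lemma power_family_limit:
  fixes S :: "real \<Rightarrow> complex^'n^'n" and C :: "nat \<Rightarrow> nat \<Rightarrow> complex^'n^'n"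
  assumes x: "\<And>n k. 0 \<le> x n k" and C: "\<And>n k. psd (C n k)"
    and sub: "\<And>n h. (\<Sum>k\<le>n. h \<bullet> (C n k *v h)) \<le> (norm h)\<^sup>2"
    and herm: "\<And>s. 0 \<le> s \<Longrightarrow> conj_transpose (S s) = S s"
    and lim: "\<And>s h. 0 \<le> s \<Longrightarrow> (\<lambda>n. \<Sum>k\<le>n. rpow (x n k) s * (h \<bullet> (C n k *v h))) \<longlonglongrightarrow> h \<bullet> (S s *v h)"
  shows "power_family S"
proof
  have C_nonneg: "0 \<le> h \<bullet> (C n k *v h)" for h n k
    using C by (simp add: psd_iff)
  show "psd (S s)" if "0 \<le> s" for s
    unfolding psd_iff
  proof (intro conjI allI)
    show "0 \<le> h \<bullet> (S s *v h)" for h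
      by (rule LIMSEQ_le_const[OF lim[OF that]])
        (auto intro!: sum_nonneg mult_nonneg_nonneg C_nonneg simp: rpow_def)
  qed (rule herm[OF that])
  show "0 \<le> a * (h \<bullet> (S u *v h)) + b * (h \<bullet> (S v *v h)) + c * (h \<bullet> (S 0 *v h))"
    if "0 \<le> u" "0 \<le> v" and nonneg: "\<And>t. 0 \<le> t \<Longrightarrow> 0 \<le> a * rpow t u + b * rpow t v + c"
    for u v a b c h
  proof (rule LIMSEQ_le_const)
    let ?F = "\<lambda>s n. \<Sum>k\<le>n. rpow (x n k) s * (h \<bullet> (C n k *v h))"
    show "(\<lambda>n. a * ?F u n + b * ?F v n + c * ?F 0 n) \<longlonglongrightarrow>
        a * (h \<bullet> (S u *v h)) + b * (h \<bullet> (S v *v h)) + c * (h \<bullet> (S 0 *v h))"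
      using that by (intro tendsto_intros lim) auto
    have "a * ?F u n + b * ?F v n + c * ?F 0 n =
        (\<Sum>k\<le>n. (a * rpow (x n k) u + b * rpow (x n k) v + c) * (h \<bullet> (C n k *v h)))" for n
      by (simp add: sum_distrib_left sum.distrib distrib_right mult.assoc rpow_def[of _ 0])
    then show "\<exists>N. \<forall>n\<ge>N. 0 \<le> a * ?F u n + b * ?F v n + c * ?F 0 n"
      using nonneg x C_nonneg by (auto intro!: sum_nonneg mult_nonneg_nonneg)
  qed
  show S0: "h \<bullet> (S 0 *v h) \<le> (norm h)\<^sup>2" for h
    by (rule LIMSEQ_le_const2[OF lim]) (use sub in \<open>auto simp: rpow_def\<close>)
  show "(norm (S s *v h))\<^sup>2 \<le> h \<bullet> (S (2 * s) *v h)" if s: "0 \<le> s" for s h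
  proof -
    \<comment> \<open>For this \<open>y\<close> the middle term of the limit inequality below is
      minus twice the squared norm of \<open>y\<close>, while \<open>S0\<close> bounds the first
      term by that squared norm once.\<close>
    define y where "y = S s *v h"
    \<comment> \<open>Convergence is given for quadratic forms; polarization carries it to the mixed
      form in \<open>y\<close> and \<open>h\<close>.\<close>
    have "(\<lambda>n. ((\<Sum>k\<le>n. rpow (x n k) s * ((y + h) \<bullet> (C n k *v (y + h)))) -
        (\<Sum>k\<le>n. rpow (x n k) s * ((y - h) \<bullet> (C n k *v (y - h))))) / 4) \<longlonglongrightarrow>
        ((y + h) \<bullet> (S s *v (y + h)) - (y - h) \<bullet> (S s *v (y - h))) / 4"
      using s by (intro tendsto_intros lim) auto
    also have "(\<lambda>n. ((\<Sum>k\<le>n. rpow (x n k) s * ((y + h) \<bullet> (C n k *v (y + h)))) -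
        (\<Sum>k\<le>n. rpow (x n k) s * ((y - h) \<bullet> (C n k *v (y - h))))) / 4) =
        (\<lambda>n. \<Sum>k\<le>n. rpow (x n k) s * (y \<bullet> (C n k *v h)))"
      using C by (simp add: hermitian_polarization[of "C _ _" y h] psd_iff sum_divide_distrib
          right_diff_distrib flip: sum_subtractf)
    finally have cross: "(\<lambda>n. \<Sum>k\<le>n. rpow (x n k) s * (y \<bullet> (C n k *v h))) \<longlonglongrightarrow> y \<bullet> (S s *v h)"
      unfolding hermitian_polarization[OF herm[OF s], of y h] .
    let ?G = "\<lambda>n. (\<Sum>k\<le>n. rpow (x n k) 0 * (y \<bullet> (C n k *v y))) -
        2 * (\<Sum>k\<le>n. rpow (x n k) s * (y \<bullet> (C n k *v h))) +
        (\<Sum>k\<le>n. rpow (x n k) (2 * s) * (h \<bullet> (C n k *v h)))"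
    have "0 \<le> y \<bullet> (S 0 *v y) - 2 * (y \<bullet> (S s *v h)) + h \<bullet> (S (2 * s) *v h)"
    proof (rule LIMSEQ_le_const)
      show "?G \<longlonglongrightarrow> y \<bullet> (S 0 *v y) - 2 * (y \<bullet> (S s *v h)) + h \<bullet> (S (2 * s) *v h)"
        using s by (intro tendsto_intros lim cross) auto
      have "0 \<le> ?G n" for n
      proof -
        have "(y - rpow (x n k) s *\<^sub>R h) \<bullet> (C n k *v (y - rpow (x n k) s *\<^sub>R h)) =
            rpow (x n k) 0 * (y \<bullet> (C n k *v y)) - 2 * (rpow (x n k) s * (y \<bullet> (C n k *v h))) +
            rpow (x n k) (2 * s) * (h \<bullet> (C n k *v h))" for k
        proof -
          have "rpow (x n k) (2 * s) = rpow (x n k) s * rpow (x n k) s"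
            by (simp add: rpow_def flip: powr_add)
          then show ?thesis
            using psd_inner_commute[OF C, of h n k y]
            by (simp add: matrix_vector_mult_diff_distrib matrix_vector_scaleR inner_diff_left
                inner_diff_right rpow_def[of _ 0] algebra_simps)
        qed
        then have "?G n = (\<Sum>k\<le>n. (y - rpow (x n k) s *\<^sub>R h) \<bullet> (C n k *v (y - rpow (x n k) s *\<^sub>R h)))"
          by (simp add: sum.distrib sum_subtractf sum_distrib_left)
        then show ?thesis
          using C_nonneg by (simp add: sum_nonneg)
      qed
      then show "\<exists>N. \<forall>n\<ge>N. 0 \<le> ?G n" by blast
    qed
    then show ?thesis
      using S0[of y] by (simp add: y_def[symmetric] power2_norm_eq_inner)
  qed
qed

section \<open>Spectrum and functional calculus\<close>

lemma scaleC_zero_left [simp]: "0 *\<^sub>C x = 0"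
  using scaleC_add_left[of 0 0 x] by simp

lemma scaleC_zero_right [simp]: "c *\<^sub>C 0 = 0"
  using scaleC_add_right[of c 0 0] by simp

lemma scaleC_one [simp]: "1 *\<^sub>C x = x"
  using scaleR_scaleC[of 1 x] by simp

lemma scaleC_minus_left: "(- c) *\<^sub>C x = - (c *\<^sub>C x)"
  using scaleC_add_left[of c "- c" x] by (simp add: eq_neg_iff_add_eq_0 add.commute)

lemma scaleC_minus_right: "c *\<^sub>C (- x) = - (c *\<^sub>C x)"
  using scaleC_add_right[of c x "- x"] by (simp add: eq_neg_iff_add_eq_0 add.commute)

lemma scaleC_diff_left: "(c - d) *\<^sub>C x = c *\<^sub>C x - d *\<^sub>C x"
  using scaleC_add_left[of c "- d" x] by (simp add: scaleC_minus_left)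

lemma scaleC_diff_right: "c *\<^sub>C (x - y) = c *\<^sub>C x - c *\<^sub>C y"
  using scaleC_add_right[of c x "- y"] by (simp add: scaleC_minus_right)

lemma scaleC_sum_right: "c *\<^sub>C (\<Sum>i\<in>I. f i) = (\<Sum>i\<in>I. c *\<^sub>C f i)"
  by (induction I rule: infinite_finite_induct) (simp_all add: scaleC_add_right)

lemma star_one [simp]: "star 1 = 1"
  by (metis mult_1_right star_mult star_star)

lemma star_zero [simp]: "star 0 = 0"
  using star_add[of 0 0] by simp

lemma star_minus: "star (- x) = - star x"
  using star_add[of x "- x"] by (simp add: eq_neg_iff_add_eq_0 add.commute)

lemma star_diff: "star (x - y) = star x - star y"
  using star_add[of x "- y"] by (simp add: star_minus)

lemma star_scaleR: "star (t *\<^sub>R x) = t *\<^sub>R star x"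
  by (simp add: scaleR_scaleC star_scaleC)

lemma star_power: "star (x ^ n) = star x ^ n"
  by (induction n) (simp_all add: star_mult power_commutes)

lemma star_sum: "star (\<Sum>i\<in>I. f i) = (\<Sum>i\<in>I. star (f i))"
  by (induction I rule: infinite_finite_induct) (simp_all add: star_add)

lemma norm_star: "norm (star x) = norm x"
proof (rule antisym)
  have le: "norm y \<le> norm (star y)" for y
  proof (cases "y = 0")
    case False
    have "norm y * norm y \<le> norm (star y) * norm y"
      using cstar_identity[of y] norm_mult_ineq[of "star y" y] by (simp add: power2_eq_square)
    then show ?thesis
      using False by simp
  qed simp
  show "norm x \<le> norm (star x)" by (rule le)
  show "norm (star x) \<le> norm x" using le[of "star x"] by (simp add: star_star)
qed

lemma tendsto_star:
  assumes "f \<longlonglongrightarrow> l"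
  shows "(\<lambda>n. star (f n)) \<longlonglongrightarrow> star l"
  using assms unfolding LIMSEQ_def dist_norm star_diff[symmetric] norm_star .

section \<open>Invertibility, location of the spectrum and order bounds\<close>

definition invertible_element :: "'a::unital_cstar_algebra \<Rightarrow> bool" where
  "invertible_element x \<longleftrightarrow> (\<exists>b. x * b = 1 \<and> b * x = 1)"

lemma spectrum_iff: "z \<in> spectrum a \<longleftrightarrow> \<not> invertible_element (a - z *\<^sub>C 1)"
  by (simp add: spectrum_def invertible_element_def)

lemma invertible_element_mult:
  assumes "invertible_element x" "invertible_element y"
  shows "invertible_element (x * y)"
proof -
  obtain b c where "x * b = 1" "b * x = 1" "y * c = 1" "c * y = 1"
    using assms by (auto simp: invertible_element_def)
  then have "(x * y) * (c * b) = 1" "(c * b) * (x * y) = 1"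
    by (metis mult.assoc mult_1_left)+
  then show ?thesis
    unfolding invertible_element_def by blast
qed

lemma invertible_element_scaleC_iff:
  assumes "c \<noteq> 0"
  shows "invertible_element (c *\<^sub>C x) \<longleftrightarrow> invertible_element x"
proof -
  have imp: "invertible_element (d *\<^sub>C y)" if y: "invertible_element y" and d: "d \<noteq> 0" for d and y :: 'a
  proof -
    obtain b where "y * b = 1" "b * y = 1"
      using y by (auto simp: invertible_element_def)
    then have "(d *\<^sub>C y) * ((1 / d) *\<^sub>C b) = 1" "((1 / d) *\<^sub>C b) * (d *\<^sub>C y) = 1"
      using d by (simp_all add: mult_scaleC_left mult_scaleC_right scaleC_scaleC)
    then show ?thesis
      unfolding invertible_element_def by blast
  qed
  show ?thesis
    using imp[of x c] imp[of "c *\<^sub>C x" "1 / c"] assms by (auto simp: scaleC_scaleC)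
qed

text \<open>The inverse is the Neumann series, which converges by completeness.\<close>

lemma invertible_one_minus:
  fixes x :: "'a::unital_cstar_algebra"
  assumes "norm x < 1"
  shows "invertible_element (1 - x)"
proof -
  have "summable (\<lambda>n. norm (x ^ n))"
  proof (rule summable_comparison_test)
    show "\<exists>N. \<forall>n\<ge>N. norm (norm (x ^ n)) \<le> norm x ^ n"
      by (simp add: norm_power_ineq)
    show "summable (\<lambda>n. norm x ^ n)"
      using assms by (simp add: summable_geometric)
  qed
  then have s: "summable (\<lambda>n. x ^ n)"
    by (rule summable_norm_cancel)
  define b where "b = (\<Sum>n. x ^ n)"
  have "(\<Sum>n. x ^ Suc n) = b - 1"
    using suminf_split_head[OF s] by (simp add: b_def)
  moreover have "(\<Sum>n. x ^ Suc n) = x * b"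
    using suminf_mult[OF s, of x] by (simp add: b_def)
  moreover have "(\<Sum>n. x ^ Suc n) = b * x"
    using suminf_mult2[OF s, of x] by (simp add: b_def power_commutes)
  ultimately have "(1 - x) * b = 1" "b * (1 - x) = 1"
    by (simp_all add: algebra_simps)
  then show ?thesis
    unfolding invertible_element_def by blast
qed

lemma spectrum_norm_le:
  assumes "z \<in> spectrum a"
  shows "cmod z \<le> norm a"
proof (rule ccontr)
  assume "\<not> cmod z \<le> norm a"
  then have z: "norm a < cmod z" by simp
  then have "z \<noteq> 0" by auto
  then have "norm ((1 / z) *\<^sub>C a) < 1"
    using z by (simp add: norm_scaleC norm_divide divide_less_eq)
  then have "invertible_element ((- z) *\<^sub>C (1 - (1 / z) *\<^sub>C a))"
    using \<open>z \<noteq> 0\<close> by (simp add: invertible_one_minus invertible_element_scaleC_iff)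
  also have "(- z) *\<^sub>C (1 - (1 / z) *\<^sub>C a) = a - z *\<^sub>C 1"
    using \<open>z \<noteq> 0\<close> by (simp add: scaleC_diff_right scaleC_scaleC scaleC_minus_left)
  finally show False
    using assms by (simp add: spectrum_iff)
qed

text \<open>Shifting \<open>a\<close> by the imaginary number \<open>i t\<close> changes the square of the norm by at most
  \<open>t\<^sup>2\<close>, but moves a non-real spectral value by an amount linear in \<open>t\<close>.\<close>

lemma selfadjoint_spectrum_real:
  assumes "star a = a" "z \<in> spectrum a"
  shows "z \<in> \<real>"
proof (rule ccontr)
  assume "z \<notin> \<real>"
  then have im: "Im z \<noteq> 0"
    by (simp add: complex_is_Real_iff)
  have bound: "(Re z)\<^sup>2 + (Im z + t)\<^sup>2 \<le> (norm a)\<^sup>2 + t\<^sup>2" for t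
  proof -
    define u where "u = a + (\<i> * of_real t) *\<^sub>C 1"
    have "z + \<i> * of_real t \<in> spectrum u"
      using assms(2) by (simp add: spectrum_iff u_def scaleC_add_left)
    then have "(cmod (z + \<i> * of_real t))\<^sup>2 \<le> (norm u)\<^sup>2"
      by (intro power_mono spectrum_norm_le) auto
    also have "(norm u)\<^sup>2 = norm (star u * u)"
      by (simp add: cstar_identity)
    also have "star u * u = a * a + (of_real (t\<^sup>2)) *\<^sub>C 1"
      using assms(1) by (simp add: u_def star_add star_scaleC scaleC_minus_left scaleC_diff_right algebra_simps
          mult_scaleC_left mult_scaleC_right scaleC_scaleC power2_eq_square)
    also have "norm \<dots> \<le> norm (a * a) + t\<^sup>2"
      by (rule order_trans[OF norm_triangle_ineq]) (simp add: norm_scaleC norm_power)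
    also have "norm (a * a) = (norm a)\<^sup>2"
      using cstar_identity[of a] assms(1) by simp
    finally show ?thesis
      by (simp add: cmod_power2)
  qed
  \<comment> \<open>After cancelling the square of \<open>t\<close>, \<open>bound\<close> controls
    \<open>2 * Im z * t\<close> by the squared norm of \<open>a\<close>; this choice exceeds that by
    1.\<close>
  define t where "t = ((norm a)\<^sup>2 + 1) / (2 * Im z)"
  have "2 * Im z * t = (norm a)\<^sup>2 + 1"
    using im by (simp add: t_def)
  moreover have "(Re z)\<^sup>2 + (Im z)\<^sup>2 + 2 * Im z * t \<le> (norm a)\<^sup>2"
    using bound[of t] by (simp add: power2_eq_square algebra_simps)
  ultimately show False
    using zero_le_power2[of "Re z"] zero_le_power2[of "Im z"] by linarith
qed

text \<open>The spectrum of \<open>x\<close> lies in the disc of radius \<open>norm x\<close> about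
  0; reflecting and shifting it moves it into the right half-plane. This gives access to positive
  maps on self-adjoint elements without a decomposition into positive parts.\<close>

lemma positive_norm_minus:
  assumes "star x = x"
  shows "positive_element (norm x *\<^sub>R 1 - x)"
  unfolding positive_element_def
proof (intro conjI ballI)
  show sa: "star (norm x *\<^sub>R 1 - x) = norm x *\<^sub>R 1 - x"
    using assms by (simp add: star_diff star_scaleR)
  fix z assume z: "z \<in> spectrum (norm x *\<^sub>R 1 - x)"
  then show "z \<in> \<real>"
    using selfadjoint_spectrum_real sa by blast
  have "norm x *\<^sub>R 1 - x - z *\<^sub>C 1 = (-1) *\<^sub>C (x - (of_real (norm x) - z) *\<^sub>C 1)"
    by (simp add: scaleC_diff_left scaleC_diff_right scaleC_minus_left scaleR_scaleC)
  then have "of_real (norm x) - z \<in> spectrum x"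
    using z by (simp add: spectrum_iff invertible_element_scaleC_iff)
  then have "cmod (of_real (norm x) - z) \<le> norm x"
    by (rule spectrum_norm_le)
  then show "0 \<le> Re z"
    using abs_Re_le_cmod[of "of_real (norm x) - z"] by simp
qed

text \<open>The C*-identity squares the norm at each doubling of the exponent, hence the powers of
  two.\<close>

lemma norm_selfadjoint_power:
  assumes "star a = a"
  shows "norm (a ^ 2 ^ k) = norm a ^ 2 ^ k"
proof (induction k)
  case (Suc k)
  have "a ^ 2 ^ Suc k = star (a ^ 2 ^ k) * a ^ 2 ^ k"
    using assms by (simp add: star_power mult_2 power_add)
  then have "norm (a ^ 2 ^ Suc k) = (norm (a ^ 2 ^ k))\<^sup>2"
    by (simp only: cstar_identity)
  then show ?case
    by (simp add: Suc power_mult[symmetric] mult.commute)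
qed simp

section \<open>The spectral radius of a self-adjoint element\<close>

definition is_inverse :: "'a::unital_cstar_algebra \<Rightarrow> 'a \<Rightarrow> bool" where
  "is_inverse x b \<longleftrightarrow> x * b = 1 \<and> b * x = 1"

text \<open>Partial fractions: 1/(1 - y^2) is the mean of 1/(1 - y) and 1/(1 + y).\<close>

lemma is_inverse_one_minus_square:
  assumes "is_inverse (1 - y) b" "is_inverse (1 + y) c"
  shows "is_inverse (1 - y * y) ((1 / 2) *\<^sub>R (b + c))"
proof -
  have "(1 - y * y) * (b + c) = (1 + y) * ((1 - y) * b) + (1 - y) * ((1 + y) * c)"
    "(b + c) * (1 - y * y) = (b * (1 - y)) * (1 + y) + (c * (1 + y)) * (1 - y)"
    by (simp_all add: algebra_simps)
  then have "(1 - y * y) * (b + c) = (1 + y) + (1 - y)" "(b + c) * (1 - y * y) = (1 + y) + (1 - y)"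
    using assms by (simp_all only: is_inverse_def mult_1_left mult_1_right)
  then have "(1 - y * y) * (b + c) = 2 *\<^sub>R 1" "(b + c) * (1 - y * y) = 2 *\<^sub>R 1"
    by (simp_all add: scaleR_2)
  then show ?thesis
    by (simp add: is_inverse_def)
qed

text \<open>The resolvent identity reduces the claim to a uniform bound on \<open>R\<close>, which
  follows from local bounds and compactness of the closed disc.\<close>

lemma resolvent_Lipschitz:
  fixes a :: "'a::unital_cstar_algebra"
  assumes "norm a \<le> 1" and inv: "\<And>w. cmod w \<le> 1 \<Longrightarrow> is_inverse (1 - w *\<^sub>C a) (R w)"
  shows "\<exists>L\<ge>0. \<forall>w v. cmod w \<le> 1 \<longrightarrow> cmod v \<le> 1 \<longrightarrow> norm (R w - R v) \<le> L * cmod (w - v)"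
proof -
  have diff: "norm (R w - R v) \<le> cmod (w - v) * norm (R w) * norm (R v)"
    if "cmod w \<le> 1" "cmod v \<le> 1" for w v
  proof -
    have "R w * ((1 - v *\<^sub>C a) * R v) = R w" "(R w * (1 - w *\<^sub>C a)) * R v = R v"
      using inv that by (simp_all add: is_inverse_def)
    then have "R w - R v = R w * ((1 - v *\<^sub>C a) * R v) - (R w * (1 - w *\<^sub>C a)) * R v"
      by simp
    also have "\<dots> = (w - v) *\<^sub>C (R w * a * R v)"
      by (simp add: algebra_simps mult_scaleC_left mult_scaleC_right scaleC_diff_left)
    finally have "norm (R w - R v) = cmod (w - v) * norm (R w * a * R v)"
      by (simp add: norm_scaleC)
    also have "\<dots> \<le> cmod (w - v) * (norm (R w) * 1 * norm (R v))"
      using assms(1)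
      by (intro mult_left_mono order_trans[OF norm_mult_ineq] mult_right_mono
          order_trans[OF norm_mult_ineq]) auto
    finally show ?thesis by (simp add: mult.assoc)
  qed
  \<comment> \<open>The radius makes \<open>cmod (w - v) * norm (R v)\<close> at most 1/2, so that
    half of \<open>norm (R w)\<close> can be absorbed.\<close>
  define U where "U v = ball v (1 / (2 * norm (R v) + 1))" for v
  have pos: "0 < 2 * norm (R v) + 1" for v
    using norm_ge_zero[of "R v"] by linarith
  have loc: "norm (R w) \<le> 2 * norm (R v)" if "cmod w \<le> 1" "cmod v \<le> 1" "w \<in> U v" for w v
  proof -
    have "cmod (w - v) < 1 / (2 * norm (R v) + 1)"
      using that(3) by (simp add: U_def dist_norm norm_minus_commute)
    then have "cmod (w - v) * (2 * norm (R v) + 1) < 1"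
      using pos[of v] by (simp add: less_divide_eq)
    moreover have "cmod (w - v) * (2 * norm (R v) + 1) = 2 * (cmod (w - v) * norm (R v)) + cmod (w - v)"
      by (simp add: algebra_simps)
    ultimately have "cmod (w - v) * norm (R v) \<le> 1 / 2"
      using norm_ge_zero[of "w - v"] by linarith
    then have "cmod (w - v) * norm (R v) * norm (R w) \<le> 1 / 2 * norm (R w)"
      by (rule mult_right_mono) simp
    moreover have "norm (R w) \<le> norm (R v) + norm (R w - R v)"
      by norm
    ultimately show ?thesis
      using diff[OF that(1,2)] by (simp add: mult_ac)
  qed
  have "cball 0 1 \<subseteq> (\<Union>v\<in>cball 0 1. U v)"
  proof
    fix v :: complex assume "v \<in> cball 0 1"
    moreover have "v \<in> U v"
      using pos[of v] by (simp add: U_def)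
    ultimately show "v \<in> (\<Union>v\<in>cball 0 1. U v)" by blast
  qed
  then obtain F where F: "F \<subseteq> cball 0 1" "finite F" "cball 0 1 \<subseteq> (\<Union>v\<in>F. U v)"
    using compactE_image[of "cball 0 1 :: complex set" "cball 0 1" U] by (auto simp: U_def)
  define C where "C = (\<Sum>v\<in>F. 2 * norm (R v))"
  have C: "norm (R w) \<le> C" if w: "cmod w \<le> 1" for w
  proof -
    obtain v where v: "v \<in> F" "w \<in> U v"
      using F(3) w by (metis UN_E mem_cball_0 subsetD)
    then have "norm (R w) \<le> 2 * norm (R v)"
      using F(1) w by (intro loc) auto
    also have "\<dots> \<le> C"
      unfolding C_def using v F(2) by (intro member_le_sum) auto
    finally show ?thesis .
  qed
  have "0 \<le> C"
    unfolding C_def by (intro sum_nonneg) simp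
  show ?thesis
  proof (intro exI[of _ "C * C"] conjI allI impI)
    fix w v :: complex assume wv: "cmod w \<le> 1" "cmod v \<le> 1"
    have "norm (R w - R v) \<le> cmod (w - v) * norm (R w) * norm (R v)"
      by (rule diff[OF wv])
    also have "\<dots> \<le> cmod (w - v) * C * C"
      using C wv \<open>0 \<le> C\<close> by (intro mult_mono mult_nonneg_nonneg) auto
    finally show "norm (R w - R v) \<le> C * C * cmod (w - v)"
      by (simp add: mult_ac)
  qed (use \<open>0 \<le> C\<close> in simp)
qed

text \<open>Averaging the resolvent over the \<open>2\<^sup>k\<close>-th roots of unity gives the inverse of
  \<open>1 - w\<^sup>n a\<^sup>n\<close> for \<open>n = 2\<^sup>k\<close>, with a Lipschitz constant that does not depend on \<open>k\<close>.\<close>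

lemma resolvent_average:
  fixes a :: "'a::unital_cstar_algebra"
  assumes inv: "\<And>w. cmod w \<le> 1 \<Longrightarrow> is_inverse (1 - w *\<^sub>C a) (R w)"
    and lip: "\<And>w v. cmod w \<le> 1 \<Longrightarrow> cmod v \<le> 1 \<Longrightarrow> norm (R w - R v) \<le> L * cmod (w - v)"
    and "0 \<le> L" "0 \<le> \<rho>" "\<rho> \<le> 1"
  shows "\<exists>Q. \<forall>w. cmod w \<le> 1 \<longrightarrow> is_inverse (1 - w ^ 2 ^ k *\<^sub>C a ^ 2 ^ k) (Q w) \<and>
    norm (Q w - Q (of_real \<rho> * w)) \<le> L * (1 - \<rho>)"
proof (induction k)
  case 0
  have "norm (R w - R (of_real \<rho> * w)) \<le> L * (1 - \<rho>)" if w: "cmod w \<le> 1" for w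
  proof -
    have "cmod (of_real \<rho> * w) \<le> 1"
      using w assms by (simp add: norm_mult mult_le_one)
    then have "norm (R w - R (of_real \<rho> * w)) \<le> L * cmod (w - of_real \<rho> * w)"
      by (rule lip[OF w])
    also have "w - of_real \<rho> * w = of_real (1 - \<rho>) * w"
      by (simp add: algebra_simps)
    also have "L * cmod \<dots> \<le> L * ((1 - \<rho>) * 1)"
      unfolding norm_mult norm_of_real using w assms by (intro mult_left_mono mult_mono) auto
    finally show ?thesis by simp
  qed
  then show ?case
    using inv by (intro exI[of _ R]) simp
next
  case (Suc k)
  then obtain Q where Q: "\<And>w. cmod w \<le> 1 \<Longrightarrow> is_inverse (1 - w ^ 2 ^ k *\<^sub>C a ^ 2 ^ k) (Q w)"
    and lipQ: "\<And>w. cmod w \<le> 1 \<Longrightarrow> norm (Q w - Q (of_real \<rho> * w)) \<le> L * (1 - \<rho>)"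
    by blast
  \<comment> \<open>A root of -1 of order 2^k: replacing \<open>w\<close> by
    \<open>\<zeta> * w\<close> turns \<open>1 - y\<close> into \<open>1 + y\<close>.\<close>
  define \<zeta> where "\<zeta> = cis (pi / 2 ^ k)"
  have "\<zeta> ^ 2 ^ k = cis (real (2 ^ k) * (pi / 2 ^ k))"
    unfolding \<zeta>_def by (rule Complex.DeMoivre)
  then have \<zeta>: "cmod \<zeta> = 1" "\<zeta> ^ 2 ^ k = -1"
    by (simp_all add: \<zeta>_def)
  define Q' where "Q' w = (1 / 2) *\<^sub>R (Q w + Q (\<zeta> * w))" for w
  have "is_inverse (1 - w ^ 2 ^ Suc k *\<^sub>C a ^ 2 ^ Suc k) (Q' w) \<and>
      norm (Q' w - Q' (of_real \<rho> * w)) \<le> L * (1 - \<rho>)" if w: "cmod w \<le> 1" for w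
  proof
    define y where "y = w ^ 2 ^ k *\<^sub>C a ^ 2 ^ k"
    have zw: "cmod (\<zeta> * w) \<le> 1"
      using w \<zeta> by (simp add: norm_mult)
    have "is_inverse (1 - y) (Q w)"
      unfolding y_def by (rule Q[OF w])
    moreover have "is_inverse (1 + y) (Q (\<zeta> * w))"
      using Q[OF zw] by (simp add: y_def power_mult_distrib \<zeta> scaleC_minus_left)
    ultimately have "is_inverse (1 - y * y) (Q' w)"
      unfolding Q'_def by (rule is_inverse_one_minus_square)
    also have "y * y = w ^ 2 ^ Suc k *\<^sub>C a ^ 2 ^ Suc k"
      by (simp add: y_def mult_scaleC_left mult_scaleC_right scaleC_scaleC mult_2 power_add)
    finally show "is_inverse (1 - w ^ 2 ^ Suc k *\<^sub>C a ^ 2 ^ Suc k) (Q' w)" .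
    have "Q' w - Q' (of_real \<rho> * w) =
        (1 / 2) *\<^sub>R ((Q w - Q (of_real \<rho> * w)) + (Q (\<zeta> * w) - Q (of_real \<rho> * (\<zeta> * w))))"
      by (simp add: Q'_def scaleR_right_distrib scaleR_right_diff_distrib mult.left_commute)
    also have "norm \<dots> \<le> (1 / 2) * (L * (1 - \<rho>) + L * (1 - \<rho>))"
      using norm_triangle_le[OF add_mono[OF lipQ[OF w] lipQ[OF zw]]] by simp
    finally show "norm (Q' w - Q' (of_real \<rho> * w)) \<le> L * (1 - \<rho>)" by simp
  qed
  then show ?case by blast
qed

text \<open>If the spectrum lay in the open unit disc, the averaged resolvents \<open>Q\<close>
  would vary little between \<rho> and 1, uniformly in \<open>k\<close>. At \<rho> they are close to
  1 for large \<open>k\<close>, hence also at 1; but then \<open>b\<close>, a high power of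
  \<open>a\<close>, would have norm below 1, while the C*-identity gives it norm 1.\<close>

lemma selfadjoint_spectral_radius_ge_one:
  fixes a :: "'a::unital_cstar_algebra"
  assumes "star a = a" "norm a = 1"
  shows "\<exists>z\<in>spectrum a. 1 \<le> cmod z"
proof (rule ccontr)
  assume neg: "\<not> (\<exists>z\<in>spectrum a. 1 \<le> cmod z)"
  have "\<exists>b. is_inverse (1 - w *\<^sub>C a) b" if w: "cmod w \<le> 1" for w
  proof (cases "w = 0")
    case True
    then show ?thesis by (auto simp: is_inverse_def)
  next
    case False
    have "1 \<le> cmod (1 / w)"
      using False w by (simp add: norm_divide le_divide_eq)
    then have "invertible_element (a - (1 / w) *\<^sub>C 1)"
      using neg by (auto simp: spectrum_iff)
    then have "invertible_element ((- w) *\<^sub>C (a - (1 / w) *\<^sub>C 1))"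
      using False by (simp add: invertible_element_scaleC_iff)
    also have "(- w) *\<^sub>C (a - (1 / w) *\<^sub>C 1) = 1 - w *\<^sub>C a"
      using False by (simp add: scaleC_diff_right scaleC_scaleC scaleC_minus_left)
    finally show ?thesis
      by (simp add: invertible_element_def is_inverse_def)
  qed
  then obtain R where R: "\<And>w. cmod w \<le> 1 \<Longrightarrow> is_inverse (1 - w *\<^sub>C a) (R w)"
    by metis
  obtain L where L: "0 \<le> L"
    "\<And>w v. cmod w \<le> 1 \<Longrightarrow> cmod v \<le> 1 \<Longrightarrow> norm (R w - R v) \<le> L * cmod (w - v)"
    using resolvent_Lipschitz[of a R] R assms(2) by (metis order_refl)
  \<comment> \<open>First \<rho> is fixed so that the variation is at most 1/5; then
    \<open>k\<close> makes the power of \<rho> at most 1/6. These put \<open>Q 1\<close> within 2/5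
    of 1, which bounds \<open>norm b\<close> by 4/5.\<close>
  define \<rho> where "\<rho> = 1 - 1 / (5 * (L + 1))"
  have \<rho>: "0 \<le> \<rho>" "\<rho> < 1" "L * (1 - \<rho>) \<le> 1 / 5"
    using L(1) by (simp_all add: \<rho>_def divide_simps)
  obtain k where "\<rho> ^ k < 1 / 6"
    using real_arch_pow_inv[of "1/6" \<rho>] \<rho> by auto
  moreover have "\<rho> ^ 2 ^ k \<le> \<rho> ^ k"
    using \<rho> by (intro power_decreasing) (auto intro: less_imp_le)
  ultimately have k: "\<rho> ^ 2 ^ k \<le> 1 / 6" by linarith
  obtain Q where Q: "\<And>w. cmod w \<le> 1 \<Longrightarrow> is_inverse (1 - w ^ 2 ^ k *\<^sub>C a ^ 2 ^ k) (Q w)"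
    and lipQ: "\<And>w. cmod w \<le> 1 \<Longrightarrow> norm (Q w - Q (of_real \<rho> * w)) \<le> L * (1 - \<rho>)"
    using resolvent_average[where a = a and R = R and L = L and \<rho> = \<rho> and k = k, OF R L(2)] L(1) \<rho>
    by (auto simp: less_imp_le)
  define b where "b = a ^ 2 ^ k"
  have nb: "norm b = 1"
    unfolding b_def norm_selfadjoint_power[OF assms(1)] by (simp add: assms(2))
  define y where "y = of_real \<rho> ^ 2 ^ k *\<^sub>C b"
  have ny: "norm y \<le> 1 / 6"
    using k nb \<rho> by (simp add: y_def norm_scaleC norm_power)
  define q where "q = Q (of_real \<rho>)"
  have "is_inverse (1 - y) q"
    unfolding y_def q_def b_def using \<rho> by (intro Q) simp
  then have "q - 1 = q * y"
    by (simp add: is_inverse_def algebra_simps)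
  then have "norm (q - 1) \<le> norm q * norm y"
    by (metis norm_mult_ineq)
  also have "\<dots> \<le> norm q * (1 / 6)"
    using ny by (intro mult_left_mono) auto
  finally have q: "norm (q - 1) \<le> norm q / 6" by simp
  moreover have "norm q \<le> norm (q - 1) + 1"
    using norm_triangle_ineq[of "q - 1" 1] by simp
  ultimately have "norm (q - 1) \<le> 1 / 5" by simp
  moreover have "norm (Q 1 - q) \<le> 1 / 5"
    using lipQ[of 1] \<rho>(3) by (simp add: q_def)
  ultimately have e: "norm (Q 1 - 1) \<le> 2 / 5"
    using norm_triangle_ineq[of "Q 1 - q" "q - 1"] by simp
  have "is_inverse (1 - b) (Q 1)"
    using Q[of 1] by (simp add: b_def)
  then have "b = (Q 1 - 1) - b * (Q 1 - 1)"
    by (simp add: is_inverse_def algebra_simps)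
  then have "norm b \<le> norm (Q 1 - 1) + norm (b * (Q 1 - 1))"
    by (metis norm_triangle_ineq4)
  also have "\<dots> \<le> 2 / 5 + 1 * (2 / 5)"
    using e nb norm_mult_ineq[of b "Q 1 - 1"] by simp
  finally show False
    using nb by simp
qed

lemma selfadjoint_spectral_radius:
  fixes a :: "'a::unital_cstar_algebra"
  assumes "star a = a"
  shows "\<exists>z\<in>spectrum a. norm a \<le> cmod z"
proof (cases "a = 0")
  case True
  then have "0 \<in> spectrum a"
    by (simp add: spectrum_iff invertible_element_def)
  then show ?thesis
    using True by auto
next
  case False
  define c where "c = (1 / norm a) *\<^sub>R a"
  have "\<exists>z\<in>spectrum c. 1 \<le> cmod z"
    using False assms by (intro selfadjoint_spectral_radius_ge_one) (simp_all add: c_def star_scaleR)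
  then obtain z where z: "\<not> invertible_element (c - z *\<^sub>C 1)" "1 \<le> cmod z"
    by (auto simp: spectrum_iff)
  have "a - (of_real (norm a) * z) *\<^sub>C 1 = of_real (norm a) *\<^sub>C (c - z *\<^sub>C 1)"
    using False by (simp add: c_def scaleC_diff_right scaleC_scaleC scaleR_scaleC)
  then have "of_real (norm a) * z \<in> spectrum a"
    using z False by (simp add: spectrum_iff invertible_element_scaleC_iff)
  moreover have "norm a \<le> cmod (of_real (norm a) * z)"
    using z(2) mult_left_mono[of 1 "cmod z" "norm a"] by (simp add: norm_mult)
  ultimately show ?thesis by blast
qed

section \<open>Polynomials in an element and spectral mapping\<close>

lemma poly_at_extend: "degree P \<le> n \<Longrightarrow> poly_at P a = (\<Sum>i\<le>n. coeff P i *\<^sub>R a ^ i)"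
  unfolding poly_at_def by (rule sum.mono_neutral_left) (auto simp: coeff_eq_0)

lemma poly_at_add: "poly_at (P + Q) a = poly_at P a + poly_at Q a"
proof -
  define n where "n = max (degree P) (degree Q)"
  have "degree (P + Q) \<le> n" "degree P \<le> n" "degree Q \<le> n"
    by (simp_all add: n_def degree_add_le_max)
  then show ?thesis
    by (simp add: poly_at_extend[of _ n] scaleR_left_distrib sum.distrib)
qed

lemma poly_at_smult: "poly_at (smult c P) a = c *\<^sub>R poly_at P a"
  using poly_at_extend[of "smult c P" "degree P" a]
  by (simp add: degree_smult_le poly_at_def scaleR_right.sum)

lemma poly_at_diff: "poly_at (P - Q) a = poly_at P a - poly_at Q a"
  using poly_at_add[of P "- Q" a] poly_at_smult[of "-1" Q a] by simp

lemma poly_at_0 [simp]: "poly_at 0 a = 0"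
  by (simp add: poly_at_def)

lemma poly_at_1 [simp]: "poly_at 1 a = 1"
  by (simp add: poly_at_def)

lemma poly_at_sum: "poly_at (\<Sum>i\<in>I. f i) a = (\<Sum>i\<in>I. poly_at (f i) a)"
  by (induction I rule: infinite_finite_induct) (simp_all add: poly_at_add)

lemma star_poly_at: "star a = a \<Longrightarrow> star (poly_at P a) = poly_at P a"
  by (simp add: poly_at_def star_sum star_scaleR star_power)

text \<open>Complex coefficients, so that every polynomial splits into linear factors.\<close>

definition cpoly_at :: "complex poly \<Rightarrow> 'a::unital_cstar_algebra \<Rightarrow> 'a" where
  "cpoly_at P a = (\<Sum>i\<le>degree P. coeff P i *\<^sub>C a ^ i)"

lemma cpoly_at_extend: "degree P \<le> n \<Longrightarrow> cpoly_at P a = (\<Sum>i\<le>n. coeff P i *\<^sub>C a ^ i)"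
  unfolding cpoly_at_def by (rule sum.mono_neutral_left) (auto simp: coeff_eq_0)

lemma cpoly_at_pCons: "cpoly_at (pCons c P) a = c *\<^sub>C 1 + a * cpoly_at P a"
proof -
  have "cpoly_at (pCons c P) a = (\<Sum>i\<le>Suc (degree P). coeff (pCons c P) i *\<^sub>C a ^ i)"
    by (rule cpoly_at_extend) (rule degree_pCons_le)
  also have "\<dots> = c *\<^sub>C 1 + (\<Sum>i\<le>degree P. coeff P i *\<^sub>C a ^ Suc i)"
    by (subst sum.atMost_Suc_shift) simp
  also have "(\<Sum>i\<le>degree P. coeff P i *\<^sub>C a ^ Suc i) = a * cpoly_at P a"
    by (simp add: cpoly_at_def sum_distrib_left mult_scaleC_right)
  finally show ?thesis .
qed

lemma cpoly_at_add: "cpoly_at (P + Q) a = cpoly_at P a + cpoly_at Q a"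
proof -
  define n where "n = max (degree P) (degree Q)"
  have "degree (P + Q) \<le> n" "degree P \<le> n" "degree Q \<le> n"
    by (simp_all add: n_def degree_add_le_max)
  then show ?thesis
    by (simp add: cpoly_at_extend[of _ n] scaleC_add_left sum.distrib)
qed

lemma cpoly_at_smult: "cpoly_at (smult c P) a = c *\<^sub>C cpoly_at P a"
  using cpoly_at_extend[of "smult c P" "degree P" a]
  by (simp add: degree_smult_le cpoly_at_def scaleC_sum_right scaleC_scaleC)

lemma cpoly_at_linear_factor: "cpoly_at ([:- w, 1:] * P) a = (a - w *\<^sub>C 1) * cpoly_at P a"
proof -
  have "[:- w, 1:] * P = smult (- w) P + pCons 0 P"
    by simp
  then have "cpoly_at ([:- w, 1:] * P) a = (- w) *\<^sub>C cpoly_at P a + a * cpoly_at P a"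
    by (simp only: cpoly_at_add cpoly_at_smult cpoly_at_pCons) simp
  then show ?thesis
    by (simp add: scaleC_minus_left left_diff_distrib mult_scaleC_left)
qed

text \<open>Split off a root. If it lies outside the spectrum, its linear factor is invertible and
  the cofactor stays singular. A singular constant is 0, where a nonempty spectrum supplies the
  root.\<close>

lemma cpoly_at_singular_root:
  assumes "spectrum a \<noteq> {}" "\<not> invertible_element (cpoly_at P a)"
  shows "\<exists>w\<in>spectrum a. poly P w = 0"
  using assms(2)
proof (induction "degree P" arbitrary: P)
  case 0
  then obtain c where P: "P = [:c:]"
    by (metis degree_eq_zeroE)
  have "c = 0"
  proof (rule ccontr)
    assume "c \<noteq> 0"
    moreover have "cpoly_at P a = c *\<^sub>C 1"
      by (simp add: P cpoly_at_def)
    moreover have "invertible_element (1 :: 'a)"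
      by (auto simp: invertible_element_def)
    ultimately show False
      using 0 by (simp add: invertible_element_scaleC_iff)
  qed
  then show ?case
    using assms(1) P by auto
next
  case (Suc n)
  then have "\<not> constant (poly P)"
    by (simp add: constant_degree)
  then obtain w where w: "poly P w = 0"
    using fundamental_theorem_of_algebra by blast
  then obtain P' where P: "P = [:- w, 1:] * P'"
    by (metis dvdE poly_eq_0_iff_dvd)
  show ?case
  proof (cases "w \<in> spectrum a")
    case True
    then show ?thesis using w by blast
  next
    case False
    then have "\<not> invertible_element (cpoly_at P' a)"
      using Suc.prems invertible_element_mult unfolding P cpoly_at_linear_factor spectrum_iff by blast
    moreover have "n = degree P'"
    proof -
      have "P' \<noteq> 0"
        using Suc.hyps(2) P by auto
      then have "degree P = Suc (degree P')"
        unfolding P by (subst degree_mult_eq) auto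
      then show ?thesis
        using Suc.hyps(2) by simp
    qed
    ultimately show ?thesis
      using Suc.hyps(1)[of P'] by (auto simp: P)
  qed
qed

lemma poly_map_of_real: "poly (map_poly of_real P) (complex_of_real t) = of_real (poly P t)"
  by (induction P) (simp_all add: map_poly_pCons)

text \<open>One inclusion of the spectral mapping theorem, from the preceding root lemma applied to
  \<open>P\<close> minus the constant \<open>z\<close>; the point found is real because
  \<open>a\<close> is self-adjoint.\<close>

lemma spectrum_poly_at:
  assumes "star a = a" "z \<in> spectrum (poly_at P a)"
  shows "\<exists>t. complex_of_real t \<in> spectrum a \<and> z = of_real (poly P t)"
proof -
  have "poly_at P a = cpoly_at (map_poly of_real P) a"
    by (simp add: poly_at_def cpoly_at_def degree_map_poly coeff_map_poly scaleR_scaleC)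
  moreover have "cpoly_at [:- z:] a = - (z *\<^sub>C 1)"
    by (simp add: cpoly_at_def scaleC_minus_left)
  ultimately have "poly_at P a - z *\<^sub>C 1 = cpoly_at (map_poly of_real P + [:- z:]) a"
    unfolding cpoly_at_add by simp
  then have "\<not> invertible_element (cpoly_at (map_poly of_real P + [:- z:]) a)"
    using assms(2) by (simp add: spectrum_iff)
  moreover have "spectrum a \<noteq> {}"
    using selfadjoint_spectral_radius[OF assms(1)] by blast
  ultimately obtain w where w: "w \<in> spectrum a" "poly (map_poly of_real P + [:- z:]) w = 0"
    using cpoly_at_singular_root by blast
  have "w \<in> \<real>"
    using assms(1) w(1) by (rule selfadjoint_spectrum_real)
  then obtain t where "w = of_real t"
    by (rule Reals_cases)
  then show ?thesis
    using w by (auto simp: poly_map_of_real)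
qed

text \<open>Some spectral value of \<open>poly_at P a\<close> attains its norm and is a value of
  \<open>P\<close> on the spectrum of \<open>a\<close>. This estimate makes the continuous
  functional calculus well defined.\<close>

lemma norm_poly_at_le:
  assumes "star a = a" "\<And>t. complex_of_real t \<in> spectrum a \<Longrightarrow> \<bar>poly P t\<bar> \<le> e"
  shows "norm (poly_at P a) \<le> e"
proof -
  obtain z where z: "z \<in> spectrum (poly_at P a)" "norm (poly_at P a) \<le> cmod z"
    using selfadjoint_spectral_radius[of "poly_at P a"] star_poly_at assms(1) by blast
  then obtain t where "complex_of_real t \<in> spectrum a" "z = of_real (poly P t)"
    using spectrum_poly_at assms(1) by blast
  then show ?thesis
    using z assms(2)[of t] by simp
qed

lemma positive_poly_at:
  assumes "star a = a" "\<And>t. complex_of_real t \<in> spectrum a \<Longrightarrow> 0 \<le> poly P t"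
  shows "positive_element (poly_at P a)"
  unfolding positive_element_def
  using spectrum_poly_at[OF assms(1)] star_poly_at[OF assms(1)] assms(2) by fastforce

section \<open>The continuous functional calculus\<close>

text \<open>By \<open>norm_poly_at_le\<close>, any two admissible polynomial sequences come
  arbitrarily close at \<open>a\<close>. So each is Cauchy and all share one limit; the existence of
  the sequence \<open>P\<close> makes the description in \<open>cfc\<close> unique.\<close>

lemma cfc_tendsto:
  fixes a :: "'a::unital_cstar_algebra"
  assumes "star a = a"
    and P: "uniform_limit {t. complex_of_real t \<in> spectrum a} (\<lambda>k. poly (P k)) f sequentially"
  shows "(\<lambda>k. poly_at (P k) a) \<longlonglongrightarrow> cfc f a"
proof -
  let ?T = "{t. complex_of_real t \<in> spectrum a}"
  have close: "\<exists>N. \<forall>m\<ge>N. \<forall>n\<ge>N. norm (poly_at (P m) a - poly_at (Q n) a) < e"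
    if Q: "uniform_limit ?T (\<lambda>k. poly (Q k)) f sequentially" and "0 < e" for Q e
  proof -
    obtain M where M: "\<And>m t. m \<ge> M \<Longrightarrow> t \<in> ?T \<Longrightarrow> dist (poly (P m) t) (f t) < e / 3"
      using uniform_limitD[OF P, of "e / 3"] \<open>0 < e\<close> by (auto simp: eventually_sequentially)
    obtain N where N: "\<And>n t. n \<ge> N \<Longrightarrow> t \<in> ?T \<Longrightarrow> dist (poly (Q n) t) (f t) < e / 3"
      using uniform_limitD[OF Q, of "e / 3"] \<open>0 < e\<close> by (auto simp: eventually_sequentially)
    have "norm (poly_at (P m) a - poly_at (Q n) a) < e" if "m \<ge> max M N" "n \<ge> max M N" for m n
    proof -
      have "\<bar>poly (P m - Q n) t\<bar> \<le> 2 * e / 3" if "complex_of_real t \<in> spectrum a" for t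
        using M[of m t] N[of n t] that \<open>m \<ge> max M N\<close> \<open>n \<ge> max M N\<close>
          abs_triangle_ineq4[of "poly (P m) t - f t" "poly (Q n) t - f t"] by (simp add: dist_real_def)
      then have "norm (poly_at (P m - Q n) a) \<le> 2 * e / 3"
        by (rule norm_poly_at_le[OF assms(1)])
      then show ?thesis
        using \<open>0 < e\<close> by (simp add: poly_at_diff)
    qed
    then show ?thesis by blast
  qed
  have "Cauchy (\<lambda>k. poly_at (P k) a)"
    unfolding Cauchy_def dist_norm using close[OF P] by blast
  then obtain b where b: "(\<lambda>k. poly_at (P k) a) \<longlonglongrightarrow> b"
    using Cauchy_convergent by (auto simp: convergent_def)
  have lim: "(\<lambda>k. poly_at (Q k) a) \<longlonglongrightarrow> b"
    if "uniform_limit ?T (\<lambda>k. poly (Q k)) f sequentially" for Q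
  proof -
    have "(\<lambda>k. poly_at (P k) a - poly_at (Q k) a) \<longlonglongrightarrow> 0"
      unfolding LIMSEQ_iff using close[OF that] by (metis diff_zero)
    from tendsto_diff[OF b this] show ?thesis by simp
  qed
  have "cfc f a = b"
    unfolding cfc_def
  proof (rule the_equality)
    show "c = b" if "\<forall>Q. uniform_limit ?T (\<lambda>k. poly (Q k)) f sequentially \<longrightarrow>
        (\<lambda>k. poly_at (Q k) a) \<longlonglongrightarrow> c" for c
      using that P b LIMSEQ_unique by blast
  qed (use lim in blast)
  then show ?thesis
    using b by simp
qed

section \<open>Powers under a positive map\<close>

lemma complex_linear_map_scaleR:
  "complex_linear_map \<Phi> \<Longrightarrow> \<Phi> (t *\<^sub>R x) = t *\<^sub>R \<Phi> x"
  by (simp add: complex_linear_map_def scaleR_scaleC vec_eq_iff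
      scaleR_conv_of_real[where 'a = complex])

text \<open>\<Phi> sends \<open>norm x *\<^sub>R 1 - x\<close> and
  \<open>norm x *\<^sub>R 1 + x\<close> to positive semidefinite matrices. Half their difference is
  \<Phi> x up to sign, and their forms together give the bound.\<close>

lemma positive_map_hermitian_bounded:
  assumes \<Phi>: "complex_linear_map \<Phi>" "positive_map \<Phi>" "sub_unital \<Phi>" and x: "star x = x"
  shows "conj_transpose (\<Phi> x) = \<Phi> x" "\<bar>h \<bullet> (\<Phi> x *v h)\<bar> \<le> norm x * (norm h)\<^sup>2"
proof -
  have add: "\<Phi> (u + v) = \<Phi> u + \<Phi> v" for u v
    using \<Phi>(1) by (simp add: complex_linear_map_def)
  note scale = complex_linear_map_scaleR[OF \<Phi>(1)]
  have upper: "psd (norm x *\<^sub>R \<Phi> 1 - \<Phi> u)" if "star u = u" "norm u = norm x" for u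
  proof -
    have "psd (\<Phi> (norm u *\<^sub>R 1 + (-1) *\<^sub>R u))"
      using \<Phi>(2) positive_norm_minus[OF that(1)] by (simp add: positive_map_def)
    then show ?thesis
      unfolding add scale using that(2) by simp
  qed
  have minus: "\<Phi> (- x) = - \<Phi> x"
    using scale[of "-1" x] by simp
  have p1: "psd (norm x *\<^sub>R \<Phi> 1 - \<Phi> x)"
    using upper[OF x] by simp
  have p2: "psd (norm x *\<^sub>R \<Phi> 1 + \<Phi> x)"
    using upper[of "- x"] x by (simp add: star_minus minus)
  have "conj_transpose ((1 / 2) *\<^sub>R ((norm x *\<^sub>R \<Phi> 1 + \<Phi> x) - (norm x *\<^sub>R \<Phi> 1 - \<Phi> x))) =
      (1 / 2) *\<^sub>R ((norm x *\<^sub>R \<Phi> 1 + \<Phi> x) - (norm x *\<^sub>R \<Phi> 1 - \<Phi> x))"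
    using p1 p2 unfolding psd_iff by (simp only: conj_transpose_scaleR conj_transpose_diff)
  moreover have "(1 / 2) *\<^sub>R ((norm x *\<^sub>R \<Phi> 1 + \<Phi> x) - (norm x *\<^sub>R \<Phi> 1 - \<Phi> x)) = \<Phi> x"
    by (simp flip: scaleR_2)
  ultimately show "conj_transpose (\<Phi> x) = \<Phi> x"
    by simp
  have "h \<bullet> (\<Phi> 1 *v h) \<le> (norm h)\<^sup>2"
    using \<Phi>(3) unfolding sub_unital_def loewner_le_def psd_iff
    by (simp add: matrix_vector_mult_diff_rdistrib inner_diff_right power2_norm_eq_inner)
  then have "norm x * (h \<bullet> (\<Phi> 1 *v h)) \<le> norm x * (norm h)\<^sup>2"
    by (rule mult_left_mono) simp
  moreover have scaleR_mat: "h \<bullet> ((t *\<^sub>R M) *v h) = t * (h \<bullet> (M *v h))" for t and M :: "complex^'b^'b"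
      and h :: "complex^'b"
    by (simp add: scaleR_matrix_vector)
  ultimately show "\<bar>h \<bullet> (\<Phi> x *v h)\<bar> \<le> norm x * (norm h)\<^sup>2"
    using p1 p2 unfolding psd_iff
    by (auto simp: abs_le_iff matrix_vector_mult_diff_rdistrib matrix_vector_mult_add_rdistrib
        inner_diff_right inner_add_right scaleR_mat dest!: spec[of _ h])
qed

section \<open>Bernstein approximation of powers\<close>

definition Bernstein_poly :: "real \<Rightarrow> nat \<Rightarrow> nat \<Rightarrow> real poly" where
  "Bernstein_poly M n k =
    pcompose (smult (real (n choose k)) ([:0, 1:] ^ k * [:1, -1:] ^ (n - k))) [:0, 1 / M:]"

lemma poly_Bernstein_poly: "poly (Bernstein_poly M n k) t = Bernstein n k (t / M)"
  by (simp add: Bernstein_poly_def poly_pcompose Bernstein_def)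

lemma sum_Bernstein_poly: "(\<Sum>k\<le>n. Bernstein_poly M n k) = 1"
  by (rule poly_eq_poly_eq_iff[THEN iffD1]) (simp add: fun_eq_iff poly_sum poly_Bernstein_poly)

text \<open>Bernstein's theorem for the power rescaled to the unit interval; for nonzero
  \<open>s\<close> it is continuous at 0 because \<open>s\<close> is positive.\<close>

lemma Bernstein_poly_uniform_limit:
  assumes "0 < M" "0 \<le> s" "T \<subseteq> {0..M}"
  shows "uniform_limit T
    (\<lambda>n. poly (\<Sum>k\<le>n. smult (rpow (M * (real k / real n)) s) (Bernstein_poly M n k)))
    (\<lambda>t. rpow t s) sequentially"
proof (rule uniform_limitI)
  fix e :: real assume "0 < e"
  define g where "g u = rpow (M * u) s" for u
  have "continuous_on {0..1} g"
  proof (cases "s = 0")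
    case False
    then have "continuous_on {0..1} (\<lambda>u. (M * u) powr s)"
      using assms by (intro continuous_on_powr' continuous_intros) auto
    then show ?thesis
      using False by (simp add: g_def[abs_def] rpow_def)
  qed (simp add: g_def[abs_def] rpow_def)
  then obtain N where N: "\<And>n u. N \<le> n \<Longrightarrow> u \<in> {0..1} \<Longrightarrow>
      \<bar>g u - (\<Sum>k\<le>n. g (k / n) * Bernstein n k u)\<bar> < e"
    using Bernstein_Weierstrass[OF _ \<open>0 < e\<close>, of g] by blast
  show "\<forall>\<^sub>F n in sequentially. \<forall>t\<in>T. dist
      (poly (\<Sum>k\<le>n. smult (rpow (M * (real k / real n)) s) (Bernstein_poly M n k)) t) (rpow t s) < e"
    unfolding eventually_sequentially
  proof (intro exI[of _ N] allI impI ballI)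
    fix n t assume "N \<le> n" "t \<in> T"
    then have "t / M \<in> {0..1}"
      using assms by auto
    from N[OF \<open>N \<le> n\<close> this] show "dist
        (poly (\<Sum>k\<le>n. smult (rpow (M * (real k / real n)) s) (Bernstein_poly M n k)) t) (rpow t s) < e"
      using assms(1) by (simp add: poly_sum poly_Bernstein_poly g_def dist_real_def abs_minus_commute)
  qed
qed

text \<open>Bernstein polynomials are nonnegative on an interval containing the spectrum and sum to
  1. Their images \<open>C n k\<close> are therefore positive semidefinite with sum \<Phi> 1, and
  serve as the weights in \<open>power_family_limit\<close>.\<close>

lemma power_family_positive_map:
  fixes \<Phi> :: "'a::unital_cstar_algebra \<Rightarrow> complex^'n^'n"
  assumes \<Phi>: "complex_linear_map \<Phi>" "positive_map \<Phi>" "sub_unital \<Phi>" and A: "positive_element A"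
  shows "power_family (\<lambda>s. \<Phi> (pos_power A s))"
proof -
  have sa: "star A = A"
    using A by (simp add: positive_element_def)
  \<comment> \<open>The summand 1 keeps \<open>M\<close> positive when \<open>A = 0\<close>, so that
    rescaling by \<open>M\<close> makes sense.\<close>
  define M where "M = norm A + 1"
  have M: "0 < M"
    by (simp add: M_def add_nonneg_pos)
  define T where "T = {t. complex_of_real t \<in> spectrum A}"
  have T: "T \<subseteq> {0..M}"
  proof
    fix t assume "t \<in> T"
    then have "0 \<le> t" "\<bar>t\<bar> \<le> norm A"
      using A spectrum_norm_le[of "of_real t" A] by (auto simp: T_def positive_element_def)
    then show "t \<in> {0..M}"
      by (simp add: M_def)
  qed
  define P where "P s n = (\<Sum>k\<le>n. smult (rpow (M * (real k / real n)) s) (Bernstein_poly M n k))" for s n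
  define C where "C n k = (if k \<le> n then \<Phi> (poly_at (Bernstein_poly M n k) A) else 0)" for n k
  have add: "\<Phi> (u + v) = \<Phi> u + \<Phi> v" for u v
    using \<Phi>(1) by (simp add: complex_linear_map_def)
  note scale = complex_linear_map_scaleR[OF \<Phi>(1)]
  have sum: "\<Phi> (\<Sum>i\<in>I. f i) = (\<Sum>i\<in>I. \<Phi> (f i))" if "finite I" for f and I :: "nat set"
    using that scale[of 0 0] by (induction I rule: finite_induct) (simp_all add: add)
  have form_sum: "h \<bullet> ((\<Sum>k\<le>n. c k *\<^sub>R D k) *v h) = (\<Sum>k\<le>n. c k * (h \<bullet> (D k *v h)))"
    for h :: "complex^'n" and c D and n :: nat
    by (induction n) (simp_all add: matrix_vector_mult_add_rdistrib inner_add_right scaleR_matrix_vector)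
  have \<Phi>P: "\<Phi> (poly_at (P s n) A) = (\<Sum>k\<le>n. rpow (M * (real k / real n)) s *\<^sub>R C n k)" for s n
    by (simp add: P_def poly_at_sum poly_at_smult sum scale C_def)
  have lim: "(\<lambda>n. poly_at (P s n) A) \<longlonglongrightarrow> pos_power A s" if "0 \<le> s" for s
    unfolding pos_power_def
  proof (rule cfc_tendsto[OF sa])
    show "uniform_limit {t. complex_of_real t \<in> spectrum A} (\<lambda>k. poly (P s k))
        (\<lambda>t. if s = 0 then 1 else t powr s) sequentially"
      using Bernstein_poly_uniform_limit[OF M that T] by (simp add: P_def T_def rpow_def)
  qed
  have star_pow: "star (pos_power A s) = pos_power A s" if "0 \<le> s" for s
    using LIMSEQ_unique[OF tendsto_star[OF lim[OF that]]] lim[OF that] by (simp add: star_poly_at[OF sa])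
  show ?thesis
  proof (rule power_family_limit[where x = "\<lambda>n k. M * (real k / real n)" and C = C])
    show "0 \<le> M * (real k / real n)" for n k
      using M by simp
    show "psd (C n k)" for n k
    proof (cases "k \<le> n")
      case True
      have "positive_element (poly_at (Bernstein_poly M n k) A)"
      proof (rule positive_poly_at[OF sa])
        fix t assume "complex_of_real t \<in> spectrum A"
        then have "t \<in> {0..M}"
          using T by (auto simp: T_def)
        then show "0 \<le> poly (Bernstein_poly M n k) t"
          using M by (simp add: poly_Bernstein_poly Bernstein_nonneg)
      qed
      then show ?thesis
        using \<Phi>(2) True by (simp add: C_def positive_map_def)
    next
      case False
      then show ?thesis
        by (simp add: C_def psd_iff conj_transpose_def vec_eq_iff)
    qed
    show "(\<Sum>k\<le>n. h \<bullet> (C n k *v h)) \<le> (norm h)\<^sup>2" for n h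
    proof -
      have "(\<Sum>k\<le>n. C n k) = \<Phi> (poly_at (\<Sum>k\<le>n. Bernstein_poly M n k) A)"
        by (simp add: C_def sum poly_at_sum)
      then have "(\<Sum>k\<le>n. h \<bullet> (C n k *v h)) = h \<bullet> (\<Phi> 1 *v h)"
        using form_sum[of h "\<lambda>_. 1" "C n" n] by (simp add: sum_Bernstein_poly)
      also have "\<dots> \<le> norm (1 :: 'a) * (norm h)\<^sup>2"
        using positive_map_hermitian_bounded(2)[OF \<Phi>, of 1 h] by simp
      finally show ?thesis by simp
    qed
    show "conj_transpose (\<Phi> (pos_power A s)) = \<Phi> (pos_power A s)" if "0 \<le> s" for s
      by (rule positive_map_hermitian_bounded(1)[OF \<Phi> star_pow[OF that]])
    show "(\<lambda>n. \<Sum>k\<le>n. rpow (M * (real k / real n)) s * (h \<bullet> (C n k *v h))) \<longlonglongrightarrow>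
        h \<bullet> (\<Phi> (pos_power A s) *v h)" if "0 \<le> s" for s h
    proof -
      have null: "(\<lambda>n. norm (poly_at (P s n) A - pos_power A s) * (norm h)\<^sup>2) \<longlonglongrightarrow> 0"
        using tendsto_mult_right[OF tendsto_norm_zero[OF LIM_zero[OF lim[OF that]]], of "(norm h)\<^sup>2"]
        by simp
      \<comment> \<open>The difference of the two forms is the form of \<Phi> at a self-adjoint
        element, which its norm controls.\<close>
      have le: "norm (h \<bullet> (\<Phi> (poly_at (P s n) A) *v h) - h \<bullet> (\<Phi> (pos_power A s) *v h)) \<le>
          norm (poly_at (P s n) A - pos_power A s) * (norm h)\<^sup>2" for n
      proof -
        define d where "d = poly_at (P s n) A - pos_power A s"
        have "poly_at (P s n) A = d + pos_power A s"
          by (simp add: d_def)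
        then have "h \<bullet> (\<Phi> (poly_at (P s n) A) *v h) - h \<bullet> (\<Phi> (pos_power A s) *v h) = h \<bullet> (\<Phi> d *v h)"
          by (simp add: add matrix_vector_mult_add_rdistrib inner_add_right)
        moreover have "star d = d"
          by (simp add: d_def star_diff star_pow[OF that] star_poly_at[OF sa])
        ultimately show ?thesis
          using positive_map_hermitian_bounded(2)[OF \<Phi>, of d h] by (simp add: d_def)
      qed
      have "(\<lambda>n. h \<bullet> (\<Phi> (poly_at (P s n) A) *v h) - h \<bullet> (\<Phi> (pos_power A s) *v h)) \<longlonglongrightarrow> 0"
        by (rule Lim_null_comparison[OF eventuallyI null]) (rule le)
      then have "(\<lambda>n. h \<bullet> (\<Phi> (poly_at (P s n) A) *v h)) \<longlonglongrightarrow> h \<bullet> (\<Phi> (pos_power A s) *v h)"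
        by (rule LIM_zero_cancel)
      then show ?thesis
        by (simp add: \<Phi>P form_sum)
    qed
  qed
qed

theorem proposition1p3:
  fixes \<Phi> :: "'a::unital_cstar_algebra \<Rightarrow> complex^'n^'n"
    and A :: 'a
    and p q r :: real
  assumes "complex_linear_map \<Phi>"
    and "positive_map \<Phi>"
    and "sub_unital \<Phi>"
    and "positive_element A"
    and "0 \<le> p" and "0 \<le> q" and "0 \<le> r"
    and "min p r \<le> q / 2"
    and "max p r \<le> q"
  shows "\<exists>V :: complex^'n^'n. unitary_matrix V \<and>
    matrix_abs (\<Phi> (pos_power A p) ** \<Phi> (pos_power A q) ** \<Phi> (pos_power A r))
      \<le>\<^sub>L V ** \<Phi> (pos_power A (p + q + r)) ** conj_transpose V"
  using power_family.matrix_abs_product[OF power_family_positive_map] assms by blast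

end
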